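(* Let $d\ge2$. There is a finite constant $C$ such that for every weakly differentiable function $A$ on $\mathbb{R}^d$ with $\nabla A\in L^{d,1}(\mathbb{R}^d)$ and every $\lambda>0$, $$\lambda^d\,\big|\{x\in\mathbb{R}^d:\ \mathcal{M}(\nabla A)(x)>\lambda\}\big|\le C\,\|\nabla A\|_{L^{d,1}(\mathbb{R}^d)}^d ,$$ where $\mathcal{M}$ is the Mary Weiss maximal operator $$\mathcal{M}(\nabla A)(x)=\sup_{h\in\mathbb{R}^d\setminus\{0\}}\frac{|A(x+h)-A(x)|}{|h|}.$$
   Context: $|E|$ denotes Lebesgue measure of $E\subset\mathbb{R}^d$. $\nabla A=(\partial_1A,\dots,\partial_dA)$ and $\|\nabla A\|_{L^{d,1}(\mathbb{R}^d)}=\big\|\big(\sum_{i=1}^d|\partial_iA|^2\big)^{1/2}\big\|_{L^{d,1}(\mathbb{R}^d)}$. The Lorentz space $L^{d,1}(\mathbb{R}^d)$ is the space of measurable $g$ with $\|g\|_{L^{d,1}}=\frac1d\int_0^\infty s^{1/d}g^*(s)\,\frac{ds}{s}<\infty$, where $g^*$ is the decreasing rearrangement of $g$. In the definition of $\mathcal{M}$, $A$ denotes its continuous representative (which exists when $\nabla A\in L^{d,1}(\mathbb{R}^d)$). *)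

theory Defs
  imports "HOL-Analysis.Analysis"
begin

section \<open>Weak gradients\<close>

definition locally_integrable :: "(real^'n \<Rightarrow> 'b::{banach,second_countable_topology}) \<Rightarrow> bool" where
  "locally_integrable f \<longleftrightarrow> (\<forall>K. compact K \<longrightarrow> set_integrable lebesgue K f)"

definition partial_deriv :: "'n \<Rightarrow> (real^'n \<Rightarrow> real) \<Rightarrow> real^'n \<Rightarrow> real" where
  "partial_deriv i f x = frechet_derivative f (at x) (axis i 1)"

primrec iterated_partial :: "'n list \<Rightarrow> (real^'n \<Rightarrow> real) \<Rightarrow> real^'n \<Rightarrow> real" where
  "iterated_partial [] f = f"
| "iterated_partial (i # is) f = partial_deriv i (iterated_partial is f)"

text \<open>
  A function is smooth iff its partial derivatives of all orders are everywhere (totally)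
  differentiable; they are then automatically continuous.
\<close>

definition test_function :: "(real^'n \<Rightarrow> real) \<Rightarrow> bool" where
  "test_function \<phi> \<longleftrightarrow>
     (\<forall>is. iterated_partial is \<phi> differentiable_on UNIV) \<and> compact (closure {x. \<phi> x \<noteq> 0})"

text \<open>
  The weak gradient of a scalar function is determined only up to null sets, hence a relation.
  The norm of \<open>'b^'n\<close> is the Euclidean one, so \<open>norm (G x)\<close> is the square root of the sum of the
  squared absolute values of the weak partial derivatives.
\<close>

definition has_weak_gradient ::
    "(real^'n \<Rightarrow> 'b::{banach,second_countable_topology}) \<Rightarrow> (real^'n \<Rightarrow> 'b^'n) \<Rightarrow> bool"
    (infix \<open>has'_weak'_gradient\<close> 50) where
  "A has_weak_gradient G \<longleftrightarrow>
     locally_integrable A \<and>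
     (\<forall>i. locally_integrable (\<lambda>x. G x $ i) \<and>
        (\<forall>\<phi>. test_function \<phi> \<longrightarrow>
           (LINT x|lebesgue. partial_deriv i \<phi> x *\<^sub>R A x) = - (LINT x|lebesgue. \<phi> x *\<^sub>R G x $ i)))"


section \<open>The Lorentz spaces \<open>L\<^bsup>p,1\<^esup>\<close>\<close>

definition decreasing_rearrangement :: "(real^'n \<Rightarrow> real) \<Rightarrow> real \<Rightarrow> ennreal" where
  "decreasing_rearrangement g s =
     Inf {t. emeasure lebesgue {x. t < ennreal \<bar>g x\<bar>} \<le> ennreal s}"

definition lorentz_norm :: "real \<Rightarrow> (real^'n \<Rightarrow> real) \<Rightarrow> ennreal" where
  "lorentz_norm p g =
     ennreal (1 / p) *
       (\<integral>\<^sup>+ s \<in> {0<..}. ennreal (s powr (1 / p) / s) * decreasing_rearrangement g s \<partial>lborel)"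

definition lorentz_space :: "real \<Rightarrow> (real^'n \<Rightarrow> real) set" where
  "lorentz_space p = {g. g \<in> borel_measurable lebesgue \<and> lorentz_norm p g < \<infinity>}"


section \<open>The Mary Weiss maximal operator\<close>

text \<open>
  A continuous representative is unique if it exists; \<open>continuous_rep A\<close> is unspecified otherwise.
\<close>

definition continuous_rep :: "(real^'n \<Rightarrow> 'b::real_normed_vector) \<Rightarrow> real^'n \<Rightarrow> 'b" where
  "continuous_rep A = (THE B. continuous_on UNIV B \<and> (AE x in lebesgue. B x = A x))"

text \<open>
  The operator applied to the gradient of \<open>A\<close>, written as a function of \<open>A\<close>: its definition refers
  to the gradient only through \<open>A\<close>.
\<close>

definition mary_weiss :: "(real^'n \<Rightarrow> 'b::real_normed_vector) \<Rightarrow> real^'n \<Rightarrow> ennreal" where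
  "mary_weiss A x =
     (SUP h\<in>-{0}. ennreal (norm (continuous_rep A (x + h) - continuous_rep A x) / norm h))"

end

theory Submission
  imports Defs
begin

text \<open>
  For a product bump \<open>\<phi>\<close> of scale \<open>r\<close> at \<open>x\<close>, replacing a single one-dimensional factor by another one
  of the same mass changes \<open>\<phi>\<close> by the partial derivative of a test function. Hence the averages of
  \<open>A\<close> against such bumps change, under moving or halving, by at most \<open>C r\<^bsup>1-d\<^esup> \<integral>\<^bsub>Q(x,r)\<^esub> |\<nabla>A|\<close>. Writing
  \<open>|\<nabla>A|\<close> as the integral of its superlevel sets, the sum of these bounds over dyadic scales is at most
  \<open>C \<integral> |{|\<nabla>A| > t} \<inter> Q(x,r)|\<^bsup>1/d\<^esup> dt\<close>, the \<open>L\<^bsup>d,1\<^esup>\<close> norm of \<open>\<nabla>A\<close> restricted to \<open>Q(x,r)\<close>; here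
  \<open>d \<ge> 2\<close> makes the sum over the large scales converge. So the averages converge to a continuous
  representative whose increments over distance \<open>r\<close> are bounded by this local norm. The \<open>d\<close>-th powers of
  the local norms are superadditive over disjoint sets, and a Vitali covering of the set where
  \<open>\<M>(\<nabla>A) > \<lambda>\<close> concludes.
\<close>

section \<open>Smooth functions of one variable\<close>

text \<open>Scaling ties the exponent to the dimension. If \<open>|G| > t\<close> occupies measure m
  = rho^d in the cube, then scale r contributes to height t at most a constant times r^(1-d)
  min(r^d, rho^d). Up to constants this is r for r below rho and rho (rho/r)^(d-1) above; for d = 1
  every large scale would cost rho. The dyadic sum leaves rho = m^(1/d), and the integral of m^(1/d)
  over t is the L^{d,1} norm written with the distribution function. A test function must have
  differentiable partial derivatives of every order. Products of functions of one variable reduce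
  this to one dimension, since a partial derivative acts on a single factor. Two factors of equal
  mass have a difference with a compactly supported primitive, and that primitive is bounded
  independently of the scale: this gains one power of r over the bump, whose size is r^(-d), and
  yields r^(1-d). The bumps are not normalised, so the limit of the averages is a fixed positive
  multiple \<open>mass\<close> of the function, divided out at the end.\<close>

definition flat :: "nat \<Rightarrow> real \<Rightarrow> real" where
  "flat k t = (if t \<le> 0 then 0 else exp (- (1 / t)) / t ^ k)"

lemma flat_right_limit: "(flat k \<longlongrightarrow> 0) (at_right 0)"
proof -
  have "((\<lambda>t. inverse t ^ k / exp (inverse t)) \<longlongrightarrow> (0::real)) (at_right 0)"
    by (rule filterlim_compose[OF tendsto_power_div_exp_0 filterlim_inverse_at_top_right])
  moreover have "\<forall>\<^sub>F t in at_right 0. inverse t ^ k / exp (inverse t) = flat k t"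
    by (rule eventually_at_rightI[of 0 1])
       (auto simp: flat_def exp_minus divide_simps power_inverse)
  ultimately show ?thesis by (rule Lim_transform_eventually)
qed

lemma flat_limit: "(flat k \<longlongrightarrow> 0) (at 0)"
proof -
  have "(flat k \<longlongrightarrow> 0) (at_left 0)"
    by (rule tendsto_eventually, rule eventually_at_leftI[of "-1"]) (auto simp: flat_def)
  with flat_right_limit show ?thesis by (simp add: filterlim_at_split)
qed

text \<open>The index \<open>k\<close> is there so that the derivative stays in the family. At 0 the
  difference quotient of \<open>flat k\<close> is \<open>flat (Suc k)\<close>, which tends to
  0.\<close>

lemma flat_has_derivative:
  "(flat k has_real_derivative - real k * flat (Suc k) t + flat (k + 2) t) (at t)"
proof (cases "t = 0")
  case True
  have "((\<lambda>h. flat k h / h) \<longlongrightarrow> 0) (at 0)"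
    by (rule Lim_transform_eventually[OF flat_limit[of "Suc k"]], rule eventuallyI)
       (auto simp: flat_def)
  with True show ?thesis by (simp add: DERIV_def flat_def)
next
  case False
  show ?thesis
  proof (cases "t < 0")
    case True
    have "((\<lambda>_. 0) has_real_derivative 0) (at t)" by simp
    then have "(flat k has_real_derivative 0) (at t)"
      by (rule has_field_derivative_transform_within_open[of _ _ _ "{..<0}"])
         (use True in \<open>auto simp: flat_def\<close>)
    with True show ?thesis by (simp add: flat_def)
  next
    case False
    with \<open>t \<noteq> 0\<close> have t: "t > 0" by simp
    have "((\<lambda>t. exp (- inverse t) * inverse t ^ k) has_real_derivative
        exp (- inverse t) * (inverse t)\<^sup>2 * inverse t ^ k
          + exp (- inverse t) * (real k * inverse t ^ (k - 1) * - (inverse t)\<^sup>2)) (at t)"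
      by (rule derivative_eq_intros refl | use t in force)+
         (simp add: power2_eq_square)
    also have "exp (- inverse t) * (inverse t)\<^sup>2 * inverse t ^ k
          + exp (- inverse t) * (real k * inverse t ^ (k - 1) * - (inverse t)\<^sup>2)
        = - real k * flat (Suc k) t + flat (k + 2) t"
      using t by (cases k) (auto simp: flat_def field_simps power2_eq_square)
    finally have "((\<lambda>t. exp (- inverse t) * inverse t ^ k) has_real_derivative
        - real k * flat (Suc k) t + flat (k + 2) t) (at t)" .
    then show ?thesis
      by (rule has_field_derivative_transform_within_open[of _ _ _ "{0<..}"])
         (use t in \<open>auto simp: flat_def field_simps\<close>)
  qed
qed

text \<open>Closure under primitives admits the antiderivative of a bump.\<close>

inductive smooth1 :: "(real \<Rightarrow> real) \<Rightarrow> bool" where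
  flat: "smooth1 (flat k)"
| const: "smooth1 (\<lambda>_. c)"
| add: "smooth1 f \<Longrightarrow> smooth1 g \<Longrightarrow> smooth1 (\<lambda>t. f t + g t)"
| mult: "smooth1 f \<Longrightarrow> smooth1 g \<Longrightarrow> smooth1 (\<lambda>t. f t * g t)"
| affine: "smooth1 f \<Longrightarrow> smooth1 (\<lambda>t. f (a * t + b))"
| primitive: "smooth1 f \<Longrightarrow> (\<And>t. (F has_real_derivative f t) (at t)) \<Longrightarrow> smooth1 F"

text \<open>The generators are chosen so that, by induction, derivatives stay in the class;
  iterating this gives derivatives of every order. For \<open>primitive\<close> the derivative is a
  premise.\<close>

lemma smooth1_derivative:
  assumes "smooth1 f"
  obtains f' where "smooth1 f'" "\<And>t. (f has_real_derivative f' t) (at t)"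
proof -
  have "\<exists>f'. smooth1 f' \<and> (\<forall>t. (f has_real_derivative f' t) (at t))"
    using assms
  proof induction
    case (flat k)
    have "smooth1 (\<lambda>t. - real k * flat (Suc k) t + flat (k + 2) t)"
      by (intro smooth1.intros)
    then show ?case using flat_has_derivative by blast
  next
    case (const c)
    then show ?case by (intro exI[of _ "\<lambda>_. 0"]) (auto intro: smooth1.const)
  next
    case (add f g)
    then obtain f' g' where "smooth1 f'" "\<forall>t. (f has_real_derivative f' t) (at t)"
      "smooth1 g'" "\<forall>t. (g has_real_derivative g' t) (at t)" by blast
    then show ?case
      by (intro exI[of _ "\<lambda>t. f' t + g' t"]) (auto intro: smooth1.add derivative_intros)
  next
    case (mult f g)
    then obtain f' g' where "smooth1 f'" "\<forall>t. (f has_real_derivative f' t) (at t)"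
      "smooth1 g'" "\<forall>t. (g has_real_derivative g' t) (at t)" by blast
    with mult.hyps show ?case
      by (intro exI[of _ "\<lambda>t. f' t * g t + g' t * f t"])
         (auto intro: smooth1.add smooth1.mult derivative_intros)
  next
    case (affine f a b)
    then obtain f' where f': "smooth1 f'" "\<And>t. (f has_real_derivative f' t) (at t)" by blast
    have "((\<lambda>t. f (a * t + b)) has_real_derivative f' (a * t + b) * a) (at t)" for t
      by (rule DERIV_chain'[OF _ f'(2), simplified mult.commute[of a]])
         (auto intro!: derivative_eq_intros)
    moreover have "smooth1 (\<lambda>t. f' (a * t + b) * a)"
      by (rule smooth1.mult[OF smooth1.affine[OF f'(1)] smooth1.const])
    ultimately show ?case by blast
  qed blast
  then show thesis using that by blast
qed

lemma smooth1_family_derivative: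
  assumes "\<And>i. smooth1 (f i)"
  obtains f' where "\<And>i. smooth1 (f' i)" "\<And>i t. (f i has_real_derivative f' i t) (at t)"
proof -
  have "\<forall>i. \<exists>f'. smooth1 f' \<and> (\<forall>t. (f i has_real_derivative f' t) (at t))"
    using smooth1_derivative[OF assms] by blast
  from choice[OF this] show thesis using that by blast
qed

lemma smooth1_continuous:
  assumes "smooth1 f"
  shows "continuous_on S f"
proof -
  obtain f' where "\<And>t. (f has_real_derivative f' t) (at t)"
    using smooth1_derivative[OF assms] by blast
  then show ?thesis
    by (intro continuous_at_imp_continuous_on ballI DERIV_isCont)
qed

lemma smooth1_diff: "smooth1 f \<Longrightarrow> smooth1 g \<Longrightarrow> smooth1 (\<lambda>t. f t - g t)"
  using smooth1.add[of f "\<lambda>t. (-1) * g t"] smooth1.mult[OF smooth1.const, of g "-1"] by simp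

lemma smooth1_rescale: "smooth1 f \<Longrightarrow> smooth1 (\<lambda>t. f ((t - a) / s))"
  using smooth1.affine[of f "1 / s" "- a / s"] by (simp add: diff_divide_distrib)

text \<open>On (-1,1) this is exp(-2/(1-t^2)), the standard mollifier without normalisation.\<close>

definition bump :: "real \<Rightarrow> real" where
  "bump t = flat 0 (1 + t) * flat 0 (1 - t)"

text \<open>The primitive of \<open>bump\<close>. The lower limit lies strictly left of the support,
  so that each t >= -1 is interior to \<open>{-2..t + 1}\<close> and the fundamental theorem of
  calculus gives a two-sided derivative.\<close>

definition step :: "real \<Rightarrow> real" where
  "step t = integral {-2..t} bump"

lemma smooth1_bump: "smooth1 bump"
  using smooth1.mult[OF smooth1.affine[OF smooth1.flat[of 0], of 1 1]
      smooth1.affine[OF smooth1.flat[of 0], of "-1" 1]]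
  by (simp add: bump_def[abs_def] add.commute)

lemma bump_nonneg: "0 \<le> bump t"
  by (auto simp: bump_def flat_def)

lemma bump_le_1: "bump t \<le> 1"
  unfolding bump_def by (rule mult_le_one) (auto simp: flat_def)

lemma bump_pos: "\<bar>t\<bar> < 1 \<Longrightarrow> 0 < bump t"
  by (auto simp: bump_def flat_def)

lemma bump_eq_0: "1 \<le> \<bar>t\<bar> \<Longrightarrow> bump t = 0"
  by (auto simp: bump_def flat_def)

lemma bump_integrable: "bump integrable_on {a..b}"
  by (intro integrable_continuous_real smooth1_continuous smooth1_bump)

lemma step_eq_0: "t \<le> -1 \<Longrightarrow> step t = 0"
  unfolding step_def by (subst integral_cong[of _ _ "\<lambda>_. 0"]) (auto simp: bump_eq_0)

lemma step_eq:
  assumes "1 \<le> t"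
  shows "step t = step 1"
proof -
  have "step 1 + integral {1..t} bump = step t"
    unfolding step_def using assms by (intro Henstock_Kurzweil_Integration.integral_combine bump_integrable) auto
  moreover have "integral {1..t} bump = 0" by (subst integral_cong[of _ _ "\<lambda>_. 0"]) (auto simp: bump_eq_0)
  ultimately show ?thesis by simp
qed

lemma step_has_derivative: "(step has_real_derivative bump t) (at t)"
proof (cases "t < -1")
  case True
  have "((\<lambda>_. 0) has_real_derivative 0) (at t)" by simp
  then have "(step has_real_derivative 0) (at t)"
    by (rule has_field_derivative_transform_within_open[of _ _ _ "{..<-1}"])
       (use True in \<open>auto simp: step_eq_0\<close>)
  with True show ?thesis by (simp add: bump_eq_0)
next
  case False
  have "((\<lambda>u. integral {-2..u} bump) has_vector_derivative bump t) (at t within {-2..t + 1})"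
    using False by (intro integral_has_vector_derivative smooth1_continuous smooth1_bump) auto
  moreover have "at t within {-2..t + 1} = at t"
    by (rule at_within_interior) (use False in auto)
  moreover have "step = (\<lambda>u. integral {-2..u} bump)"
    by (rule ext) (rule step_def)
  ultimately show ?thesis
    by (simp only: has_real_derivative_iff_has_vector_derivative)
qed

lemma smooth1_step: "smooth1 step"
  by (rule smooth1.primitive[OF smooth1_bump step_has_derivative])

lemma step_nonneg: "0 \<le> step t"
  unfolding step_def by (intro Henstock_Kurzweil_Integration.integral_nonneg bump_integrable bump_nonneg)

lemma step_le_2: "step t \<le> 2"
proof -
  have *: "step u \<le> 2" if u: "-1 \<le> u" "u \<le> 1" for u
  proof -
    have "step (-1) + integral {-1..u} bump = step u"
      unfolding step_def using u by (intro Henstock_Kurzweil_Integration.integral_combine bump_integrable) auto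
    moreover have "integral {-1..u} bump \<le> integral {-1..u} (\<lambda>_. 1)"
      by (intro integral_le bump_integrable bump_le_1) auto
    ultimately show ?thesis using u by (simp add: step_eq_0)
  qed
  consider "t \<le> -1" | "-1 \<le> t" "t \<le> 1" | "1 \<le> t" by linarith
  then show ?thesis
    by cases (auto simp: step_eq_0 * step_eq[of t])
qed

section \<open>Products of functions of one variable as test functions\<close>

definition prodfun :: "('n::finite \<Rightarrow> real \<Rightarrow> real) \<Rightarrow> real^'n \<Rightarrow> real" where
  "prodfun f z = (\<Prod>i\<in>UNIV. f i (z $ i))"

lemma prodfun_has_derivative:
  assumes "\<And>i t. (f i has_real_derivative f' i t) (at t)"
  shows "(prodfun f has_derivative
           (\<lambda>h. \<Sum>i\<in>UNIV. f' i (z $ i) * h $ i * (\<Prod>j\<in>UNIV - {i}. f j (z $ j)))) (at z)"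
  unfolding prodfun_def[abs_def]
proof (rule has_derivative_prod)
  fix i
  have "(f i has_derivative (*) (f' i (z $ i))) (at (z $ i))"
    using assms by (simp add: has_field_derivative_def)
  then show "((\<lambda>z. f i (z $ i)) has_derivative (\<lambda>h. f' i (z $ i) * h $ i)) (at z)"
    by (rule has_derivative_compose[rotated])
       (intro bounded_linear_imp_has_derivative bounded_linear_vec_nth)
qed

lemma prodfun_update:
  "prodfun (f(i := g)) z = g (z $ i) * (\<Prod>j\<in>UNIV - {i}. f j (z $ j))"
  unfolding prodfun_def by (subst prod.remove[of _ i]) (auto intro!: prod.cong)

lemma partial_deriv_prodfun:
  assumes "\<And>i t. (f i has_real_derivative f' i t) (at t)"
  shows "partial_deriv i (prodfun f) z = prodfun (f(i := f' i)) z"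
proof -
  have "partial_deriv i (prodfun f) z =
      (\<Sum>j\<in>UNIV. f' j (z $ j) * axis i 1 $ j * (\<Prod>k\<in>UNIV - {j}. f k (z $ k)))"
    unfolding partial_deriv_def
    by (subst frechet_derivative_at[OF prodfun_has_derivative[OF assms], symmetric]) auto
  also have "\<dots> = (\<Sum>j\<in>UNIV. if j = i then f' i (z $ i) * (\<Prod>k\<in>UNIV - {i}. f k (z $ k)) else 0)"
    by (intro sum.cong) (auto simp: axis_def)
  finally show ?thesis by (simp add: prodfun_update)
qed

text \<open>Each partial derivative replaces one factor by its derivative, which is again
  \<open>smooth1\<close>. Hence products of smooth factors are stable under all iterated partials,
  and smoothness needs only first-order differentiability of such products.\<close>

lemma iterated_partial_prodfun:
  assumes "\<And>i. smooth1 (f i)"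
  shows "\<exists>g. (\<forall>i. smooth1 (g i)) \<and> iterated_partial is (prodfun f) = prodfun g"
proof (induction "is")
  case Nil
  then show ?case using assms by auto
next
  case (Cons i "is")
  then obtain g where g: "\<And>i. smooth1 (g i)" "iterated_partial is (prodfun f) = prodfun g"
    by blast
  obtain g' where g': "\<And>i. smooth1 (g' i)" "\<And>i t. (g i has_real_derivative g' i t) (at t)"
    by (rule smooth1_family_derivative[of g, OF g(1)]) blast
  have "partial_deriv i (prodfun g) = prodfun (g(i := g' i))"
    by (rule ext, rule partial_deriv_prodfun[OF g'(2)])
  then show ?case using g g' by (intro exI[of _ "g(i := g' i)"]) (auto simp del: fun_upd_apply simp: fun_upd_def)
qed

lemma prodfun_differentiable:
  assumes "\<And>i. smooth1 (f i)"
  shows "prodfun f differentiable_on UNIV"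
proof -
  obtain f' where "\<And>i t. (f i has_real_derivative f' i t) (at t)"
    by (rule smooth1_family_derivative[of f, OF assms]) blast
  from prodfun_has_derivative[of f f', OF this] show ?thesis
    unfolding differentiable_on_def differentiable_def by blast
qed

lemma prodfun_continuous:
  assumes "\<And>i. smooth1 (f i)"
  shows "continuous_on S (prodfun f)"
  by (rule continuous_on_subset[OF differentiable_imp_continuous_on[OF prodfun_differentiable]])
     (use assms in auto)

lemma prodfun_support:
  assumes "\<And>i t. f i t \<noteq> 0 \<Longrightarrow> a $ i \<le> t \<and> t \<le> b $ i"
  shows "{z. prodfun f z \<noteq> 0} \<subseteq> cbox a b"
  using assms by (auto simp: prodfun_def mem_box_cart)

lemma test_function_prodfun:
  assumes "\<And>i. smooth1 (f i)" "\<And>i t. f i t \<noteq> 0 \<Longrightarrow> a $ i \<le> t \<and> t \<le> b $ i"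
  shows "test_function (prodfun f)"
proof -
  have "closure {z. prodfun f z \<noteq> 0} \<subseteq> cbox a b"
    using prodfun_support[of f a b, OF assms(2)] by (intro closure_minimal) auto
  then have "compact (closure {z. prodfun f z \<noteq> 0})"
    by (metis bounded_cbox bounded_subset closed_closure compact_eq_bounded_closed)
  moreover have "iterated_partial is (prodfun f) differentiable_on UNIV" for "is"
  proof -
    obtain g where g: "\<And>i. smooth1 (g i)" "iterated_partial is (prodfun f) = prodfun g"
      using iterated_partial_prodfun[of f "is", OF assms(1)] by blast
    show ?thesis unfolding g(2) by (rule prodfun_differentiable[OF g(1)])
  qed
  ultimately show ?thesis unfolding test_function_def by blast
qed

section \<open>Averages against product bumps\<close>

text \<open>The scales may differ between coordinates because two bumps are compared by changing one
  coordinate at a time, through anisotropic intermediate ones. Dividing by \<open>s i\<close> gives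
  all factors the same mass.\<close>

definition boxbump :: "('n::finite \<Rightarrow> real) \<Rightarrow> ('n \<Rightarrow> real) \<Rightarrow> real^'n \<Rightarrow> real" where
  "boxbump a s = prodfun (\<lambda>i t. bump ((t - a i) / s i) / s i)"

definition bavg :: "(real^'n::finite \<Rightarrow> complex) \<Rightarrow> ('n \<Rightarrow> real) \<Rightarrow> ('n \<Rightarrow> real) \<Rightarrow> complex" where
  "bavg A a s = (LINT z|lebesgue. boxbump a s z *\<^sub>R A z)"

definition cube :: "real^'n::finite \<Rightarrow> real \<Rightarrow> (real^'n) set" where
  "cube w R = cbox (\<chi> i. w $ i - R) (\<chi> i. w $ i + R)"

lemma mem_cube: "z \<in> cube w R \<longleftrightarrow> (\<forall>i. \<bar>z $ i - w $ i\<bar> \<le> R)"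
  by (auto simp: cube_def mem_box_cart abs_le_iff algebra_simps)

lemma compact_cube [simp]: "compact (cube w R)"
  by (simp add: cube_def)

lemma lmeasurable_cube [simp]: "cube w R \<in> lmeasurable"
  by (simp add: cube_def)

lemma sets_cube [measurable, simp]: "cube w R \<in> sets lebesgue"
  by (simp add: cube_def)

lemma measure_cube:
  assumes "0 \<le> R"
  shows "measure lebesgue (cube (w::real^'n::finite) R) = (2 * R) ^ CARD('n)"
proof -
  have "w \<in> cube w R" using assms by (simp add: mem_cube)
  then have "cbox (\<chi> i. w $ i - R) (\<chi> i. w $ i + R) \<noteq> {}" unfolding cube_def by blast
  from content_cbox_cart[OF this] show ?thesis
    by (simp add: cube_def)
qed

lemma borel_measurable_lebesgue_of_continuous:
  fixes f :: "'a::euclidean_space \<Rightarrow> 'b::topological_space"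
  assumes "continuous_on UNIV f"
  shows "f \<in> borel_measurable lebesgue"
  using borel_measurable_continuous_onI[OF assms] by (intro measurable_completion) simp

lemma integrable_scaleR_local:
  fixes A :: "real^'n \<Rightarrow> 'b::{banach,second_countable_topology}"
  assumes A: "locally_integrable A" and f: "continuous_on UNIV f"
    and K: "compact K" "\<And>z. z \<notin> K \<Longrightarrow> f z = 0"
  shows "integrable lebesgue (\<lambda>z. f z *\<^sub>R A z)"
proof -
  have AK: "integrable lebesgue (\<lambda>z. indicator K z *\<^sub>R A z)"
    using A K(1) by (auto simp: locally_integrable_def set_integrable_def)
  have "bounded (f ` K)"
    by (intro compact_imp_bounded compact_continuous_image continuous_on_subset[OF f] K) auto
  then obtain M where M: "\<And>z. z \<in> K \<Longrightarrow> \<bar>f z\<bar> \<le> M"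
    by (force simp: bounded_iff)
  have fm: "f \<in> borel_measurable lebesgue"
    by (rule borel_measurable_lebesgue_of_continuous[OF f])
  have eq: "(\<lambda>z. f z *\<^sub>R A z) = (\<lambda>z. f z *\<^sub>R (indicator K z *\<^sub>R A z))"
    using K(2) by (auto simp: fun_eq_iff indicator_def)
  show ?thesis
  proof (rule Bochner_Integration.integrable_bound[OF integrable_scaleR_right[OF AK, of M]])
    show "(\<lambda>z. f z *\<^sub>R A z) \<in> borel_measurable lebesgue"
      unfolding eq by (intro borel_measurable_scaleR fm borel_measurable_integrable[OF AK])
    show "AE z in lebesgue. norm (f z *\<^sub>R A z) \<le> norm (M *\<^sub>R indicator K z *\<^sub>R A z)"
    proof (rule AE_I2)
      fix z
      show "norm (f z *\<^sub>R A z) \<le> norm (M *\<^sub>R indicator K z *\<^sub>R A z)"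
      proof (cases "z \<in> K")
        case True
        then have "\<bar>f z\<bar> \<le> \<bar>M\<bar>" using M by fastforce
        then show ?thesis using True by (auto intro: mult_right_mono)
      qed (simp add: K(2))
    qed
  qed
qed

lemma smooth1_factor: "smooth1 (\<lambda>t. bump ((t - a) / s) / s)"
  using smooth1.mult[OF smooth1_rescale[OF smooth1_bump, of a s] smooth1.const[of "1 / s"]] by simp

lemma continuous_boxbump: "continuous_on S (boxbump a s)"
  unfolding boxbump_def by (intro prodfun_continuous smooth1_factor)

lemma boxbump_nonneg: "(\<And>i. 0 < s i) \<Longrightarrow> 0 \<le> boxbump a s z"
  unfolding boxbump_def prodfun_def
  by (intro prod_nonneg) (auto intro!: divide_nonneg_pos bump_nonneg)

lemma factor_support:
  assumes "0 < s" "bump ((t - a) / s) \<noteq> 0"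
  shows "\<bar>t - a\<bar> \<le> s"
proof (rule ccontr)
  assume "\<not> \<bar>t - a\<bar> \<le> s"
  then have "1 \<le> \<bar>(t - a) / s\<bar>" using assms(1) by (simp add: divide_simps)
  with assms(2) bump_eq_0 show False by blast
qed

lemma boxbump_support:
  assumes "\<And>i. 0 < s i" "\<And>i. \<bar>a i - w $ i\<bar> + s i \<le> R" "z \<notin> cube w R"
  shows "boxbump a s z = 0"
proof -
  obtain i where i: "\<bar>z $ i - w $ i\<bar> > R" using assms(3) by (auto simp: mem_cube not_le)
  have "bump ((z $ i - a i) / s i) = 0"
    using factor_support[of "s i" "z $ i" "a i"] assms(1)[of i] assms(2)[of i] i by linarith
  then show ?thesis by (auto simp: boxbump_def prodfun_def)
qed

lemma integrable_boxbump:
  assumes "locally_integrable A" "\<And>i. 0 < s i"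
  shows "integrable lebesgue (\<lambda>z. boxbump a s z *\<^sub>R A z)"
proof (rule integrable_scaleR_local[OF assms(1) continuous_boxbump])
  define R where "R = (\<Sum>i\<in>UNIV. s i)"
  have "s i \<le> R" for i
    unfolding R_def using assms(2) by (intro member_le_sum) (auto intro: less_imp_le)
  then show "\<And>z. z \<notin> cube (\<chi> i. a i) R \<Longrightarrow> boxbump a s z = 0"
    by (intro boxbump_support[of s a "\<chi> i. a i" R] assms(2)) auto
qed simp

text \<open>Two bumps that differ in one factor only differ by a partial derivative of a test function,
  because both factors have the same mass.\<close>

definition transfer :: "('n::finite \<Rightarrow> real) \<Rightarrow> ('n \<Rightarrow> real) \<Rightarrow> 'n \<Rightarrow> real \<Rightarrow> real \<Rightarrow> real^'n \<Rightarrow> real" where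
  "transfer a s j a' s' = prodfun ((\<lambda>i t. bump ((t - a i) / s i) / s i)
     (j := \<lambda>t. step ((t - a') / s') - step ((t - a j) / s j)))"

text \<open>Left of both supports the two steps vanish; right of both they take the common value
  \<open>step 1\<close>. This cancellation is where equality of the masses enters.\<close>

lemma step_diff_support:
  assumes "0 < s" "0 < s'" "\<bar>a - w\<bar> + s \<le> R" "\<bar>a' - w\<bar> + s' \<le> R" "R < \<bar>t - w\<bar>"
  shows "step ((t - a') / s') - step ((t - a) / s) = 0"
proof (cases "w < t")
  case True
  then have "1 \<le> (t - a') / s'" "1 \<le> (t - a) / s" using assms by (auto simp: divide_simps)
  then show ?thesis by (metis step_eq diff_self)
next
  case False
  then have "(t - a') / s' \<le> -1" "(t - a) / s \<le> -1" using assms by (auto simp: divide_simps)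
  then show ?thesis by (simp add: step_eq_0)
qed

lemma transfer_smooth: "smooth1 (((\<lambda>i t. bump ((t - a i) / s i) / s i)
     (j := \<lambda>t. step ((t - a') / s') - step ((t - a j) / s j))) i)"
  by (auto intro!: smooth1_factor smooth1_diff smooth1_rescale smooth1_step)

lemma transfer_support:
  assumes "\<And>i. 0 < s i" "0 < s'" "\<And>i. \<bar>a i - w $ i\<bar> + s i \<le> R" "\<bar>a' - w $ j\<bar> + s' \<le> R"
    "((\<lambda>i t. bump ((t - a i) / s i) / s i)
     (j := \<lambda>t. step ((t - a') / s') - step ((t - a j) / s j))) i t \<noteq> 0"
  shows "\<bar>t - w $ i\<bar> \<le> R"
proof (cases "i = j")
  case True
  show ?thesis
  proof (rule ccontr)
    assume "\<not> ?thesis"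
    then have "step ((t - a') / s') - step ((t - a j) / s j) = 0"
      using assms(1)[of j] assms(2) assms(3)[of j] assms(4) True
      by (intro step_diff_support[of "s j" s' "a j" "w $ j" R]) auto
    with True assms(5) show False by simp
  qed
next
  case False
  then have "\<bar>t - a i\<bar> \<le> s i"
    using assms(5) by (intro factor_support assms(1)) auto
  with assms(3)[of i] show ?thesis by linarith
qed

lemma test_function_transfer:
  assumes "\<And>i. 0 < s i" "0 < s'"
  shows "test_function (transfer a s j a' s')"
proof -
  define R where "R = (\<Sum>i\<in>UNIV. s i) + s' + \<bar>a' - a j\<bar>"
  have "s i \<le> (\<Sum>i\<in>UNIV. s i)" for i
    using assms(1) by (intro member_le_sum) (auto intro: less_imp_le)
  then have R: "s i \<le> R" for i using assms(2) unfolding R_def by (smt (verit))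
  have R': "\<bar>a' - a j\<bar> + s' \<le> R"
    unfolding R_def using sum_nonneg[of UNIV s] assms(1) by (auto intro: less_imp_le)
  show ?thesis
    unfolding transfer_def
  proof (rule test_function_prodfun[of _ "\<chi> i. a i - R" "\<chi> i. a i + R"])
    fix i t
    assume "((\<lambda>i t. bump ((t - a i) / s i) / s i)
     (j := \<lambda>t. step ((t - a') / s') - step ((t - a j) / s j))) i t \<noteq> 0"
    then have "\<bar>t - (\<chi> i. a i) $ i\<bar> \<le> R"
      using assms R R' by (intro transfer_support[of s s' a "\<chi> i. a i" R a' j]) auto
    then show "(\<chi> i. a i - R) $ i \<le> t \<and> t \<le> (\<chi> i. a i + R) $ i" by (auto simp: abs_le_iff)
  qed (rule transfer_smooth)
qed

lemma partial_deriv_transfer: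
  assumes "\<And>i. 0 < s i" "0 < s'"
  shows "partial_deriv j (transfer a s j a' s') z = boxbump (a(j := a')) (s(j := s')) z - boxbump a s z"
proof -
  let ?f = "(\<lambda>i t. bump ((t - a i) / s i) / s i)
     (j := \<lambda>t. step ((t - a') / s') - step ((t - a j) / s j))"
  obtain f' where f': "\<And>i t. (?f i has_real_derivative f' i t) (at t)"
    by (rule smooth1_family_derivative[of ?f, OF transfer_smooth]) blast
  have step': "((\<lambda>t. step ((t - b) / r)) has_real_derivative bump ((t - b) / r) / r) (at t)"
    if "0 < r" for b r t
    using that by (auto intro!: derivative_eq_intros DERIV_chain'[OF _ step_has_derivative, THEN DERIV_cong])
  have "(?f j has_real_derivative bump ((t - a') / s') / s' - bump ((t - a j) / s j) / s j) (at t)" for t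
    using assms by (auto intro!: derivative_intros step')
  \<comment> \<open>The family \<open>f'\<close> comes from an existence statement; its
    \<open>j\<close>-th member is identified by uniqueness of derivatives.\<close>
  with f'[of j] have f'j: "f' j = (\<lambda>t. bump ((t - a') / s') / s' - bump ((t - a j) / s j) / s j)"
    by (intro ext) (rule DERIV_unique)
  have eq1: "boxbump (a(j := a')) (s(j := s')) z
      = prodfun ((\<lambda>i t. bump ((t - a i) / s i) / s i)(j := \<lambda>t. bump ((t - a') / s') / s')) z"
    unfolding boxbump_def by (rule arg_cong[where f = "\<lambda>f. prodfun f z"]) (auto simp: fun_eq_iff)
  have eq2: "boxbump a s z
      = prodfun ((\<lambda>i t. bump ((t - a i) / s i) / s i)(j := \<lambda>t. bump ((t - a j) / s j) / s j)) z"
    unfolding boxbump_def by (rule arg_cong[where f = "\<lambda>f. prodfun f z"]) (auto simp: fun_eq_iff)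
  show ?thesis
    unfolding transfer_def partial_deriv_prodfun[of ?f f', OF f'] fun_upd_upd
    by (subst eq1, subst eq2, unfold prodfun_update f'j) (simp add: algebra_simps)
qed

text \<open>The \<open>j\<close>-th factor is a difference of values in [0,2] at any scale; only the
  other d-1 factors carry a division by a scale of at least \<open>\<rho>\<close>. This is the
  origin of the power r^(1-d).\<close>

lemma transfer_bound:
  fixes z :: "real^'n::finite"
  assumes "0 < \<rho>" "\<And>i. \<rho> \<le> s i" "0 < s'" "\<And>i. \<bar>a i - w $ i\<bar> + s i \<le> R" "\<bar>a' - w $ j\<bar> + s' \<le> R"
  shows "\<bar>transfer a s j a' s' z\<bar> \<le> 2 * (1 / \<rho>) ^ (CARD('n) - 1) * indicator (cube w R) z"
proof -
  have s: "0 < s i" for i using assms(1) assms(2)[of i] by linarith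
  show ?thesis
  proof (cases "z \<in> cube w R")
    case True
    have "\<bar>step u - step v\<bar> \<le> 2" for u v
      using step_nonneg[of u] step_nonneg[of v] step_le_2[of u] step_le_2[of v] by linarith
    moreover have "\<bar>\<Prod>i\<in>UNIV - {j}. bump ((z $ i - a i) / s i) / s i\<bar> \<le> (\<Prod>i\<in>UNIV - {j}. 1 / \<rho>)"
      unfolding abs_prod
    proof (intro prod_mono conjI)
      fix i
      have "\<bar>bump ((z $ i - a i) / s i) / s i\<bar> \<le> 1 / s i"
        using s[of i] bump_nonneg bump_le_1 by (simp add: divide_right_mono)
      also have "\<dots> \<le> 1 / \<rho>" using assms(1,2) s by (simp add: frac_le)
      finally show "\<bar>bump ((z $ i - a i) / s i) / s i\<bar> \<le> 1 / \<rho>" .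
    qed simp
    ultimately show ?thesis
      using True unfolding transfer_def prodfun_update abs_mult
      by (simp add: card_Diff_singleton mult_mono)
  next
    case False
    then obtain i where "\<not> \<bar>z $ i - w $ i\<bar> \<le> R" by (auto simp: mem_cube)
    then have "((\<lambda>i t. bump ((t - a i) / s i) / s i)
       (j := \<lambda>t. step ((t - a') / s') - step ((t - a j) / s j))) i (z $ i) = 0"
      using transfer_support[OF s assms(3-5)] by blast
    then have "transfer a s j a' s' z = 0"
      unfolding transfer_def prodfun_def by (intro prod_zero finite_class.finite_UNIV bexI[of _ i] UNIV_I)
    with False show ?thesis by simp
  qed
qed

lemma bavg_transfer:
  assumes A: "A has_weak_gradient G" and s: "\<And>i. 0 < s i" "0 < s'"
  shows "bavg A (a(j := a')) (s(j := s')) - bavg A a s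
    = - (LINT z|lebesgue. transfer a s j a' s' z *\<^sub>R G z $ j)"
proof -
  have loc: "locally_integrable A" using A by (simp add: has_weak_gradient_def)
  have "bavg A (a(j := a')) (s(j := s')) - bavg A a s
      = (LINT z|lebesgue. partial_deriv j (transfer a s j a' s') z *\<^sub>R A z)"
    unfolding bavg_def
    by (subst Bochner_Integration.integral_diff[symmetric])
       (use s in \<open>auto intro!: integrable_boxbump loc simp: partial_deriv_transfer scaleR_diff_left\<close>)
  also have "\<dots> = - (LINT z|lebesgue. transfer a s j a' s' z *\<^sub>R G z $ j)"
    using A test_function_transfer[of s s' a j a'] s unfolding has_weak_gradient_def by blast
  finally show ?thesis .
qed

lemma bavg_change_one:
  fixes G :: "real^'n::finite \<Rightarrow> complex^'n"
  assumes A: "A has_weak_gradient G" and [measurable]: "(\<lambda>x. norm (G x)) \<in> borel_measurable lebesgue"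
    and "0 < \<rho>" "\<And>i. \<rho> \<le> s i" "0 < s'" "\<And>i. \<bar>a i - w $ i\<bar> + s i \<le> R" "\<bar>a' - w $ j\<bar> + s' \<le> R"
  shows "ennreal (norm (bavg A (a(j := a')) (s(j := s')) - bavg A a s))
    \<le> ennreal (2 * (1 / \<rho>) ^ (CARD('n) - 1)) * (\<integral>\<^sup>+ z \<in> cube w R. ennreal (norm (G z)) \<partial>lebesgue)"
proof -
  let ?c = "2 * (1 / \<rho>) ^ (CARD('n) - 1)"
  have s: "0 < s i" for i using assms(3) assms(4)[of i] by linarith
  have bd: "\<bar>transfer a s j a' s' z\<bar> \<le> ?c * indicator (cube w R) z" for z
    by (rule transfer_bound) (use assms in auto)
  have int: "integrable lebesgue (\<lambda>z. transfer a s j a' s' z *\<^sub>R G z $ j)"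
  proof (rule integrable_scaleR_local[where K = "cube w R"])
    show "locally_integrable (\<lambda>z. G z $ j)" using A by (simp add: has_weak_gradient_def)
    show "continuous_on UNIV (transfer a s j a' s')"
      unfolding transfer_def by (intro prodfun_continuous transfer_smooth)
    show "transfer a s j a' s' z = 0" if "z \<notin> cube w R" for z
      using bd[of z] that by simp
  qed simp
  have "ennreal (norm (bavg A (a(j := a')) (s(j := s')) - bavg A a s))
      = ennreal (norm (LINT z|lebesgue. transfer a s j a' s' z *\<^sub>R G z $ j))"
    by (simp add: bavg_transfer[OF A s assms(5)])
  also have "\<dots> \<le> (\<integral>\<^sup>+ z. ennreal (norm (transfer a s j a' s' z *\<^sub>R G z $ j)) \<partial>lebesgue)"
    by (rule integral_norm_bound_ennreal[OF int])
  also have "\<dots> \<le> (\<integral>\<^sup>+ z. ennreal (?c * indicator (cube w R) z * norm (G z)) \<partial>lebesgue)"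
    unfolding norm_scaleR real_norm_def
    using order_trans[OF abs_ge_zero bd]
    by (intro nn_integral_mono ennreal_leI mult_mono bd Finite_Cartesian_Product.norm_nth_le) auto
  also have "\<dots> = (\<integral>\<^sup>+ z. ennreal ?c * (ennreal (norm (G z)) * indicator (cube w R) z) \<partial>lebesgue)"
    using assms(3) by (intro nn_integral_cong) (auto simp: indicator_def ennreal_mult)
  also have "\<dots> = ennreal ?c * (\<integral>\<^sup>+ z \<in> cube w R. ennreal (norm (G z)) \<partial>lebesgue)"
    by (intro nn_integral_cmult) measurable
  finally show ?thesis .
qed

lemma ennreal_norm_triangle: "ennreal (norm (a + b)) \<le> ennreal (norm a) + ennreal (norm b)"
  by (subst ennreal_plus[symmetric]) (rule norm_ge_zero ennreal_leI norm_triangle_ineq)+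

lemma bavg_change:
  fixes G :: "real^'n::finite \<Rightarrow> complex^'n"
  assumes A: "A has_weak_gradient G" "(\<lambda>x. norm (G x)) \<in> borel_measurable lebesgue"
    and \<rho>: "0 < \<rho>" "\<And>i. \<rho> \<le> s i" "\<And>i. \<rho> \<le> s' i"
    and R: "\<And>i. \<bar>a i - w $ i\<bar> + s i \<le> R" "\<And>i. \<bar>a' i - w $ i\<bar> + s' i \<le> R"
  shows "ennreal (norm (bavg A a' s' - bavg A a s))
    \<le> ennreal (2 * real CARD('n) * (1 / \<rho>) ^ (CARD('n) - 1)) * (\<integral>\<^sup>+ z \<in> cube w R. ennreal (norm (G z)) \<partial>lebesgue)"
proof -
  let ?I = "\<integral>\<^sup>+ z \<in> cube w R. ennreal (norm (G z)) \<partial>lebesgue"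
  let ?c = "2 * (1 / \<rho>) ^ (CARD('n) - 1)"
  \<comment> \<open>Hybrid parameters: the coordinates in \<open>J\<close> already have their new
    values. Every hybrid bump still has scales at least \<open>\<rho>\<close> and support in the
    same cube, so each of the d changes costs the same.\<close>
  let ?m = "\<lambda>J f f' i. if i \<in> J then f' i else (f i :: real)"
  have "ennreal (norm (bavg A (?m J a a') (?m J s s') - bavg A a s)) \<le> of_nat (card J) * (ennreal ?c * ?I)" for J
  proof (induction J rule: infinite_finite_induct)
    case (insert j J)
    have m: "?m (insert j J) f f' = (?m J f f')(j := f' j)" for f f'
      by (auto simp: fun_eq_iff)
    let ?d1 = "bavg A (?m (insert j J) a a') (?m (insert j J) s s') - bavg A (?m J a a') (?m J s s')"
    let ?d2 = "bavg A (?m J a a') (?m J s s') - bavg A a s"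
    have "0 < s' j" using \<rho>(1) \<rho>(3)[of j] by linarith
    then have 1: "ennreal (norm ?d1) \<le> ennreal ?c * ?I"
      unfolding m using \<rho> R by (intro bavg_change_one[OF A]) auto
    have "ennreal (norm (?d1 + ?d2)) \<le> ennreal (norm ?d1) + ennreal (norm ?d2)"
      by (rule ennreal_norm_triangle)
    also have "\<dots> \<le> ennreal ?c * ?I + of_nat (card J) * (ennreal ?c * ?I)"
      by (intro add_mono 1 insert.IH)
    finally show ?case using insert.hyps by (simp add: distrib_right)
  qed auto
  from this[of UNIV] show ?thesis using \<rho>(1)
    by (simp add: ennreal_mult ennreal_of_nat_eq_real_of_nat mult_ac)
qed

section \<open>Level sets and the Lorentz norm of a restriction\<close>

text \<open>Needed for Tonelli in \<open>layer_cake\<close>: the function is measurable only for the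
  completed measure, so \<open>lebesgue\<close> in space is paired with \<open>lborel\<close> in
  height.\<close>

lemma sigma_finite_lebesgue: "sigma_finite_measure (lebesgue :: 'a::euclidean_space measure)"
proof
  show "\<exists>A. countable A \<and> A \<subseteq> sets (lebesgue :: 'a measure) \<and> \<Union> A = space lebesgue \<and>
      (\<forall>a\<in>A. emeasure lebesgue a \<noteq> \<infinity>)"
  proof (intro exI[of _ "range (\<lambda>n::nat. cball 0 (real n))"] conjI ballI)
    show "\<Union> (range (\<lambda>n::nat. cball (0::'a) (real n))) = space lebesgue"
      using real_arch_simple by auto
  next
    fix a :: "'a set" assume "a \<in> range (\<lambda>n::nat. cball 0 (real n))"
    then show "emeasure lebesgue a \<noteq> \<infinity>"
      using fmeasurableD2[OF lmeasurable_cball, of "0::'a"] by auto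
  qed auto
qed

interpretation lebesgue: sigma_finite_measure "lebesgue :: 'a::euclidean_space measure"
  by (rule sigma_finite_lebesgue)

interpretation lebesgue_lborel: pair_sigma_finite "lebesgue :: 'a::euclidean_space measure" "lborel :: 'b::euclidean_space measure" ..

text \<open>Meaningful only for sets \<open>S\<close> of finite measure: \<open>measure\<close> is \<open>0\<close> on sets of infinite measure.\<close>

definition level :: "('a::euclidean_space \<Rightarrow> real) \<Rightarrow> 'a set \<Rightarrow> real \<Rightarrow> real" where
  "level g S t = measure lebesgue {x \<in> S. t < g x}"

text \<open>For nonnegative \<open>g\<close> and \<open>S\<close> of finite measure, the L^{d,1}
  norm of \<open>g\<close> restricted to \<open>S\<close>, expressed by the distribution function
  instead of the rearrangement. Both the sum over scales and the sum over disjoint sets can then be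
  treated at a fixed height \<open>t\<close>.\<close>

definition lnorm :: "(real^'n::finite \<Rightarrow> real) \<Rightarrow> (real^'n) set \<Rightarrow> ennreal" where
  "lnorm g S = (\<integral>\<^sup>+ t \<in> {0<..}. ennreal (level g S t powr (1 / CARD('n))) \<partial>lborel)"

lemma level_nonneg [simp]: "0 \<le> level g S t"
  by (simp add: level_def)

lemma lmeasurable_level:
  fixes g :: "'a::euclidean_space \<Rightarrow> real"
  assumes [measurable]: "g \<in> borel_measurable lebesgue" and S: "S \<in> lmeasurable"
  shows "{x \<in> S. t < g x} \<in> lmeasurable"
proof -
  have "{x \<in> space lebesgue. t < g x} \<in> sets lebesgue" by measurable
  then have "S \<inter> {x. t < g x} \<in> lmeasurable"
    using S by (intro fmeasurable_Int_fmeasurable) auto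
  then show ?thesis by (simp add: Int_def)
qed

lemma emeasure_level:
  assumes "g \<in> borel_measurable lebesgue" "S \<in> lmeasurable"
  shows "emeasure lebesgue {x \<in> S. t < g x} = ennreal (level g S t)"
  unfolding level_def using lmeasurable_level[OF assms] by (simp add: emeasure_eq_measure2)

lemma level_mono:
  assumes "g \<in> borel_measurable lebesgue" "S \<in> lmeasurable" "T \<in> lmeasurable" "S \<subseteq> T"
  shows "level g S t \<le> level g T t"
  unfolding level_def
  by (intro measure_mono_fmeasurable fmeasurableD lmeasurable_level assms) (use assms in auto)

lemma level_le_measure:
  assumes "g \<in> borel_measurable lebesgue" "S \<in> lmeasurable"
  shows "level g S t \<le> measure lebesgue S"
  unfolding level_def
  by (intro measure_mono_fmeasurable fmeasurableD lmeasurable_level assms) auto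

lemma borel_measurable_level:
  assumes "g \<in> borel_measurable lebesgue" "S \<in> lmeasurable"
  shows "level g S \<in> borel_measurable borel"
proof -
  have "mono (\<lambda>t. - level g S t)"
    unfolding level_def
    by (intro monoI le_imp_neg_le measure_mono_fmeasurable fmeasurableD lmeasurable_level assms) auto
  then have "(\<lambda>t. - (- level g S t)) \<in> borel_measurable borel"
    by (intro borel_measurable_uminus borel_measurable_mono)
  then show ?thesis by simp
qed

lemma layer_cake:
  assumes g [measurable]: "g \<in> borel_measurable lebesgue" and g0: "\<And>x. 0 \<le> g x" and S: "S \<in> lmeasurable"
  shows "(\<integral>\<^sup>+ x \<in> S. ennreal (g x) \<partial>lebesgue) = (\<integral>\<^sup>+ t \<in> {0<..}. ennreal (level g S t) \<partial>lborel)"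
proof -
  have S' [measurable]: "S \<in> sets lebesgue" using S by auto
  let ?f = "\<lambda>x t. indicator S x * indicator {0<..} t * (if t < g x then 1 else 0 :: ennreal)"
  have meas: "(\<lambda>(x, t). ?f x t) \<in> borel_measurable (lebesgue \<Otimes>\<^sub>M lborel)"
    by measurable
  have "(\<integral>\<^sup>+ x \<in> S. ennreal (g x) \<partial>lebesgue) = (\<integral>\<^sup>+ x. (\<integral>\<^sup>+ t. ?f x t \<partial>lborel) \<partial>lebesgue)"
  proof (rule nn_integral_cong)
    fix x
    have "(\<integral>\<^sup>+ t. ?f x t \<partial>lborel) = (\<integral>\<^sup>+ t. indicator S x * indicator {0<..<g x} t \<partial>lborel)"
      by (intro nn_integral_cong) (auto simp: indicator_def)
    also have "\<dots> = indicator S x * ennreal (g x)"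
      using g0[of x] by (simp add: nn_integral_cmult)
    finally show "ennreal (g x) * indicator S x = (\<integral>\<^sup>+ t. ?f x t \<partial>lborel)"
      by (simp add: mult.commute)
  qed
  also have "\<dots> = (\<integral>\<^sup>+ t. (\<integral>\<^sup>+ x. ?f x t \<partial>lebesgue) \<partial>lborel)"
    using lebesgue_lborel.Fubini'[OF meas] by simp
  also have "\<dots> = (\<integral>\<^sup>+ t \<in> {0<..}. ennreal (level g S t) \<partial>lborel)"
  proof (rule nn_integral_cong)
    fix t
    have "(\<integral>\<^sup>+ x. ?f x t \<partial>lebesgue) = (\<integral>\<^sup>+ x. indicator {0<..} t * indicator {x \<in> S. t < g x} x \<partial>lebesgue)"
      by (intro nn_integral_cong) (auto simp: indicator_def)
    also have "\<dots> = indicator {0<..} t * emeasure lebesgue {x \<in> S. t < g x}"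
      using lmeasurable_level[OF g S] by (subst nn_integral_cmult_indicator) auto
    finally show "(\<integral>\<^sup>+ x. ?f x t \<partial>lebesgue) = ennreal (level g S t) * indicator {0<..} t"
      by (simp add: emeasure_level[OF g S] mult.commute)
  qed
  finally show ?thesis .
qed

lemma lnorm_mono:
  assumes "g \<in> borel_measurable lebesgue" "S \<in> lmeasurable" "T \<in> lmeasurable" "S \<subseteq> T"
  shows "lnorm g S \<le> lnorm g T"
  unfolding lnorm_def
  by (intro nn_integral_mono mult_right_mono ennreal_leI powr_mono2 level_mono assms) auto

text \<open>As a function of r, min(r, rho^2/r) peaks at r = rho and decays geometrically along
  dyadic scales on either side. The inductions peel off the largest scale, so the starting scale
  \<open>a\<close> is kept arbitrary.\<close>

lemma dyadic_sum_le:
  fixes a \<rho> :: real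
  assumes "0 < a" "0 \<le> \<rho>"
  shows "(\<Sum>k<n. min (a / 2 ^ k) (\<rho>\<^sup>2 / (a / 2 ^ k))) \<le> 5 * \<rho>"
proof -
  define S where "S n a = (\<Sum>k<n. min (a / 2 ^ k) (\<rho>\<^sup>2 / (a / 2 ^ k)))" for n a
  have S_Suc: "S (Suc n) a = min a (\<rho>\<^sup>2 / a) + S n (a / 2)" for n a
    unfolding S_def by (subst sum.lessThan_Suc_shift) (simp add: field_simps)
  have low: "S n a \<le> 2 * a" if "0 < a" for n a
    using that
  proof (induction n arbitrary: a)
    case (Suc n)
    from Suc.IH[of "a / 2"] Suc.prems show ?case unfolding S_Suc by (auto simp: min_def)
  qed (simp add: S_def)
  \<comment> \<open>The subtracted term makes the induction close: at \<open>a / 2\<close> it equals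
    \<open>4 * (\<rho>\<^sup>2 / a)\<close>, which pays for the new summand and for the subtracted
    term at \<open>a\<close>.\<close>
  have high: "S n a \<le> 5 * \<rho> - 2 * (\<rho>\<^sup>2 / a)" if "\<rho> < a" for n a
    using that
  proof (induction n arbitrary: a)
    case 0
    have "\<rho>\<^sup>2 \<le> \<rho> * a" using 0 assms(2) by (simp add: power2_eq_square mult_left_mono)
    moreover have "0 < a" using 0 assms(2) by linarith
    ultimately have "\<rho>\<^sup>2 / a \<le> \<rho>" by (simp add: divide_simps)
    then show ?case using assms(2) by (simp add: S_def)
  next
    case (Suc n)
    have a: "0 < a" using Suc.prems assms(2) by linarith
    have le: "S (Suc n) a \<le> \<rho>\<^sup>2 / a + S n (a / 2)" unfolding S_Suc by auto
    show ?case
    proof (cases "\<rho> < a / 2")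
      case True
      have "5 * \<rho> - 2 * (\<rho>\<^sup>2 / (a / 2)) = 5 * \<rho> - 4 * (\<rho>\<^sup>2 / a)" by simp
      with Suc.IH[OF True] have "S n (a / 2) \<le> 5 * \<rho> - 4 * (\<rho>\<^sup>2 / a)" by (simp only:)
      moreover have "0 \<le> \<rho>\<^sup>2 / a" using a by simp
      ultimately show ?thesis using le by linarith
    next
      case False
      \<comment> \<open>Here rho < a <= 2 rho, and the remaining scales fall under
        \<open>low\<close>. What has to be shown is rho^2/a + a <= 5 rho - 2 rho^2/a, a quadratic
        inequality in a.\<close>
      have "(a - \<rho>) * (2 * \<rho> - a) \<ge> 0" using False Suc.prems by (intro mult_nonneg_nonneg) auto
      moreover have "0 \<le> \<rho> * (a - \<rho>)" "0 \<le> \<rho> * a" using Suc.prems assms(2) a by auto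
      ultimately have "3 * \<rho>\<^sup>2 + a * a \<le> 5 * \<rho> * a"
        by (simp add: algebra_simps power2_eq_square)
      then have "(3 * \<rho>\<^sup>2 + a * a) / a \<le> 5 * \<rho>" using a by (simp add: divide_simps)
      then have "3 * \<rho>\<^sup>2 / a + a \<le> 5 * \<rho>" using a by (simp add: add_divide_distrib)
      with le low[of "a / 2" n] a show ?thesis by (simp add: algebra_simps)
    qed
  qed
  show ?thesis
  proof (cases "\<rho> < a")
    case True
    moreover have "0 \<le> \<rho>\<^sup>2 / a" using assms by simp
    ultimately show ?thesis using high[of a n] unfolding S_def by linarith
  next
    case False
    then show ?thesis using low[OF assms(1), of n] assms(2) unfolding S_def by linarith
  qed
qed

text \<open>The measure of a level set in a cube of half-side r is bounded by the volume (2r)^d and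
  by its measure rho^d in the large cube. The right side keeps only the decay rho^2/r at large
  scales, which is all that d = 2 provides.\<close>

lemma scaled_min_le:
  fixes r \<rho> :: real
  assumes "0 < r" "0 \<le> \<rho>" "2 \<le> d"
  shows "(1 / r) ^ (d - 1) * min ((2 * r) ^ d) (\<rho> ^ d) \<le> 2 ^ d * min r (\<rho>\<^sup>2 / r)"
proof -
  obtain m where m: "d = Suc m" "1 \<le> m" using assms(3) by (cases d) auto
  have 1: "(1 / r) ^ (d - 1) * (2 * r) ^ d = 2 ^ d * r"
    using assms(1) m by (simp add: power_mult_distrib power_divide)
  show ?thesis
  proof (cases "r \<le> \<rho>")
    case True
    then have "r * r \<le> \<rho>\<^sup>2" using assms by (simp add: power2_eq_square mult_mono)
    then have "min r (\<rho>\<^sup>2 / r) = r" using assms(1) by (simp add: min_def divide_simps)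
    moreover have "(1 / r) ^ (d - 1) * min ((2 * r) ^ d) (\<rho> ^ d) \<le> (1 / r) ^ (d - 1) * (2 * r) ^ d"
      using assms by (intro mult_left_mono) auto
    ultimately show ?thesis unfolding 1 by simp
  next
    case False
    then have "\<rho> * \<rho> \<le> r * r" using assms by (intro mult_mono) auto
    then have *: "min r (\<rho>\<^sup>2 / r) = \<rho>\<^sup>2 / r"
      using assms(1) by (auto simp: min_def divide_simps power2_eq_square)
    have "(1 / r) ^ (d - 1) * min ((2 * r) ^ d) (\<rho> ^ d) \<le> (1 / r) ^ (d - 1) * \<rho> ^ d"
      using assms by (intro mult_left_mono) auto
    also have "\<dots> = \<rho> * (\<rho> / r) ^ m" using m by (simp add: power_divide)
    \<comment> \<open>This uses d >= 2: since rho/r < 1, the power d-1 >= 1 is at most the first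
      power.\<close>
    also have "\<dots> \<le> \<rho> * (\<rho> / r) ^ 1"
      using False assms m by (intro mult_left_mono power_decreasing) auto
    also have "\<dots> = 1 * (\<rho>\<^sup>2 / r)" by (simp add: power2_eq_square)
    also have "\<dots> \<le> 2 ^ d * (\<rho>\<^sup>2 / r)" using assms by (intro mult_right_mono) auto
    finally show ?thesis by (simp add: *)
  qed
qed

text \<open>After \<open>layer_cake\<close> the sum is estimated at each height \<open>t\<close>,
  with rho the d-th root of the level set's measure in the full cube, and then integrated. The
  factor 5 is from \<open>dyadic_sum_le\<close>, the factor 2^d from
  \<open>scaled_min_le\<close>.\<close>

lemma dyadic_averages_le_lnorm:
  fixes x :: "real^'n::finite"
  assumes d: "2 \<le> CARD('n)" and g [measurable]: "g \<in> borel_measurable lebesgue" and g0: "\<And>x. 0 \<le> g x"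
    and r: "0 < r"
  shows "(\<Sum>k<n. ennreal ((1 / (r / 2 ^ k)) ^ (CARD('n) - 1)) *
      (\<integral>\<^sup>+ z \<in> cube x (r / 2 ^ k). ennreal (g z) \<partial>lebesgue)) \<le> ennreal (5 * 2 ^ CARD('n)) * lnorm g (cube x r)"
proof -
  let ?d = "CARD('n)"
  let ?r = "\<lambda>k. r / 2 ^ k"
  let ?c = "\<lambda>k. (1 / ?r k) ^ (?d - 1)"
  let ?\<rho> = "\<lambda>t. level g (cube x r) t powr (1 / ?d)"
  have [measurable]: "level g (cube x R) \<in> borel_measurable borel" for R
    by (intro borel_measurable_level g) simp
  have pt: "(\<Sum>k<n. ?c k * level g (cube x (?r k)) t) \<le> 5 * 2 ^ ?d * ?\<rho> t" for t
  proof -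
    have \<rho>d: "?\<rho> t ^ ?d = level g (cube x r) t"
    proof (cases "level g (cube x r) t = 0")
      case True
      then show ?thesis by (simp add: power_0_left)
    next
      case False
      then show ?thesis by (simp add: powr_realpow[symmetric] powr_powr)
    qed
    have "?c k * level g (cube x (?r k)) t \<le> 2 ^ ?d * min (?r k) ((?\<rho> t)\<^sup>2 / ?r k)" for k
    proof -
      have "level g (cube x (?r k)) t \<le> (2 * ?r k) ^ ?d"
        using level_le_measure[OF g lmeasurable_cube, of x "?r k" t] r by (simp add: measure_cube)
      moreover have "level g (cube x (?r k)) t \<le> ?\<rho> t ^ ?d"
      proof -
        have "?r k \<le> r" using r by (simp add: divide_simps mult_le_cancel_left1)
        then have "cube x (?r k) \<subseteq> cube x r" by (meson mem_cube order_trans subsetI)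
        then show ?thesis unfolding \<rho>d by (intro level_mono g) auto
      qed
      ultimately have "?c k * level g (cube x (?r k)) t \<le> ?c k * min ((2 * ?r k) ^ ?d) (?\<rho> t ^ ?d)"
        using r by (intro mult_left_mono) auto
      also have "\<dots> \<le> 2 ^ ?d * min (?r k) ((?\<rho> t)\<^sup>2 / ?r k)"
        using r d by (intro scaled_min_le) auto
      finally show ?thesis .
    qed
    then have "(\<Sum>k<n. ?c k * level g (cube x (?r k)) t) \<le> (\<Sum>k<n. 2 ^ ?d * min (?r k) ((?\<rho> t)\<^sup>2 / ?r k))"
      by (rule sum_mono)
    also have "\<dots> = 2 ^ ?d * (\<Sum>k<n. min (?r k) ((?\<rho> t)\<^sup>2 / ?r k))" by (simp add: sum_distrib_left)
    also have "\<dots> \<le> 2 ^ ?d * (5 * ?\<rho> t)" using r by (intro mult_left_mono dyadic_sum_le) auto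
    finally show ?thesis by (simp add: mult_ac)
  qed
  have "(\<Sum>k<n. ennreal (?c k) * (\<integral>\<^sup>+ z \<in> cube x (?r k). ennreal (g z) \<partial>lebesgue))
      = (\<Sum>k<n. \<integral>\<^sup>+ t. ennreal (?c k) * (ennreal (level g (cube x (?r k)) t) * indicator {0<..} t) \<partial>lborel)"
    by (simp add: layer_cake[OF g g0] nn_integral_cmult)
  also have "\<dots> = (\<integral>\<^sup>+ t. (\<Sum>k<n. ennreal (?c k) * (ennreal (level g (cube x (?r k)) t) * indicator {0<..} t)) \<partial>lborel)"
    by (rule nn_integral_sum[symmetric]) measurable
  also have "\<dots> \<le> (\<integral>\<^sup>+ t. ennreal (5 * 2 ^ ?d) * (ennreal (?\<rho> t) * indicator {0<..} t) \<partial>lborel)"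
  proof (rule nn_integral_mono)
    fix t
    have "(\<Sum>k<n. ennreal (?c k) * (ennreal (level g (cube x (?r k)) t) * indicator {0<..} t))
        = ennreal (\<Sum>k<n. ?c k * level g (cube x (?r k)) t) * indicator {0<..} t"
      using r by (simp add: sum_ennreal[symmetric] ennreal_mult sum_distrib_right mult.assoc)
    also have "\<dots> \<le> ennreal (5 * 2 ^ ?d * ?\<rho> t) * indicator {0<..} t"
      by (intro mult_right_mono ennreal_leI pt) simp
    finally show "(\<Sum>k<n. ennreal (?c k) * (ennreal (level g (cube x (?r k)) t) * indicator {0<..} t))
        \<le> ennreal (5 * 2 ^ ?d) * (ennreal (?\<rho> t) * indicator {0<..} t)"
      by (simp add: ennreal_mult mult.assoc)
  qed
  also have "\<dots> = ennreal (5 * 2 ^ ?d) * lnorm g (cube x r)"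
    unfolding lnorm_def by (rule nn_integral_cmult) measurable
  finally show ?thesis .
qed

section \<open>The continuous representative\<close>

text \<open>The product of d 2^d, the cost factor of one halving in \<open>mol_change\<close>, and 5
  * 2^d from \<open>dyadic_averages_le_lnorm\<close>.\<close>

definition mol_const :: "nat \<Rightarrow> real" where
  "mol_const d = 5 * real d * 4 ^ d"

lemma mol_const_nonneg: "0 \<le> mol_const d"
  by (simp add: mol_const_def)

lemma cube_shift_subset:
  assumes "\<And>i. \<bar>y $ i - x $ i\<bar> \<le> r"
  shows "cube y r \<subseteq> cube x (2 * r)"
proof
  fix z assume "z \<in> cube y r"
  then have "\<bar>z $ i - x $ i\<bar> \<le> 2 * r" for i
    using assms[of i] unfolding mem_cube by (smt (verit))
  then show "z \<in> cube x (2 * r)" by (simp add: mem_cube)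
qed

lemma mol_const_eq: "real d * 2 ^ d * (5 * 2 ^ d) = mol_const d"
  by (simp add: mol_const_def power_mult_distrib[symmetric])

lemma cube_mono: "r \<le> s \<Longrightarrow> cube x r \<subseteq> cube x s"
  by (meson mem_cube order_trans subsetI)

lemma ennreal_mult_assoc: "0 \<le> a \<Longrightarrow> 0 \<le> b \<Longrightarrow> ennreal a * (ennreal b * c) = ennreal (a * b) * c"
  by (simp add: ennreal_mult mult.assoc)

text \<open>\<open>lnorm_finite\<close> is the form in which membership in the Lorentz space enters,
  as the estimates only involve norms over sets of finite measure. It is supplied by
  \<open>lnorm_le_lorentz_norm\<close>.\<close>

locale weak_gradient =
  fixes A :: "real^'n::finite \<Rightarrow> complex" and G :: "real^'n \<Rightarrow> complex^'n"
  assumes weak: "A has_weak_gradient G"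
    and measurable_norm [measurable]: "(\<lambda>x. norm (G x)) \<in> borel_measurable lebesgue"
    and dim: "2 \<le> CARD('n)"
    and lnorm_finite: "\<And>S. S \<in> lmeasurable \<Longrightarrow> lnorm (\<lambda>x. norm (G x)) S < \<infinity>"
begin

abbreviation (input) "N S \<equiv> lnorm (\<lambda>x. norm (G x)) S"

definition mol :: "real^'n \<Rightarrow> real \<Rightarrow> complex" where
  "mol x r = bavg A (\<lambda>i. x $ i) (\<lambda>_. r)"

abbreviation (input) "I x R \<equiv> (\<integral>\<^sup>+ z \<in> cube x R. ennreal (norm (G z)) \<partial>lebesgue)"

lemma mol_change:
  assumes "0 < r" "r / 2 \<le> s" "s \<le> r"
  shows "ennreal (norm (mol x s - mol x r)) \<le> ennreal (real CARD('n) * 2 ^ CARD('n)) * (ennreal ((1 / r) ^ (CARD('n) - 1)) * I x r)"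
proof -
  have "ennreal (norm (mol x s - mol x r)) \<le> ennreal (2 * real CARD('n) * (1 / (r / 2)) ^ (CARD('n) - 1)) * I x r"
    unfolding mol_def using assms by (intro bavg_change[OF weak measurable_norm]) auto
  also have "2 * real CARD('n) * (1 / (r / 2)) ^ (CARD('n) - 1) = real CARD('n) * 2 ^ CARD('n) * (1 / r) ^ (CARD('n) - 1)"
    using dim by (cases "CARD('n)") (auto simp: power_divide algebra_simps)
  finally show ?thesis using assms(1) by (simp add: ennreal_mult mult.assoc)
qed

text \<open>Telescoping along the halvings of \<open>r\<close> down to the scale of
  \<open>s\<close>. The bound does not depend on \<open>s\<close>, which gives both the Cauchy
  property and the error of the limit.\<close>

lemma mol_le:
  assumes "0 < s" "s \<le> r"
  shows "ennreal (norm (mol x s - mol x r)) \<le> ennreal (mol_const CARD('n)) * N (cube x r)"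
proof -
  let ?r = "\<lambda>k. r / 2 ^ k"
  let ?t = "\<lambda>k. ennreal (real CARD('n) * 2 ^ CARD('n)) * (ennreal ((1 / ?r k) ^ (CARD('n) - 1)) * I x (?r k))"
  have r: "0 < r" using assms by simp
  have dyadic: "ennreal (norm (mol x (?r n) - mol x r)) \<le> (\<Sum>k<n. ?t k)" for n
  proof (induction n)
    case (Suc n)
    have "ennreal (norm (mol x (?r (Suc n)) - mol x r))
      \<le> ennreal (norm (mol x (?r n) - mol x r)) + ennreal (norm (mol x (?r (Suc n)) - mol x (?r n)))"
      using ennreal_norm_triangle[of "mol x (?r n) - mol x r" "mol x (?r (Suc n)) - mol x (?r n)"] by simp
    also have "\<dots> \<le> (\<Sum>k<n. ?t k) + ?t n"
      using r by (intro add_mono Suc.IH mol_change) (auto simp: divide_simps)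
    finally show ?case by simp
  qed simp
  \<comment> \<open>The predecessor of the least \<open>m\<close> with r/2^m < s; that least
    \<open>m\<close> is not 0 because s <= r.\<close>
  obtain n where n: "?r (Suc n) < s" "s \<le> ?r n"
  proof -
    have "\<exists>m. ?r m < s"
    proof -
      obtain m where "r / s < 2 ^ m" using real_arch_pow[of 2 "r / s"] by auto
      then show ?thesis using assms by (intro exI[of _ m]) (simp add: divide_simps mult.commute)
    qed
    then have *: "?r (LEAST m. ?r m < s) < s" by (rule LeastI_ex)
    then have "(LEAST m. ?r m < s) \<noteq> 0" using assms by (metis div_by_1 leD power_0)
    then obtain n where "(LEAST m. ?r m < s) = Suc n" by (metis not0_implies_Suc)
    with * show thesis using that[of n] not_less_Least[of n "\<lambda>m. ?r m < s"] by auto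
  qed
  have "ennreal (norm (mol x s - mol x r))
      \<le> ennreal (norm (mol x (?r n) - mol x r)) + ennreal (norm (mol x s - mol x (?r n)))"
    using ennreal_norm_triangle[of "mol x (?r n) - mol x r" "mol x s - mol x (?r n)"] by simp
  also have "\<dots> \<le> (\<Sum>k<n. ?t k) + ?t n"
    using r n by (intro add_mono dyadic mol_change) auto
  \<comment> \<open>The incomplete last move from r/2^n to \<open>s\<close> is bounded like a full
    halving and becomes summand number \<open>n\<close>.\<close>
  also have "\<dots> = ennreal (real CARD('n) * 2 ^ CARD('n)) * (\<Sum>k<Suc n. ennreal ((1 / ?r k) ^ (CARD('n) - 1)) * I x (?r k))"
    by (simp add: sum_distrib_left distrib_left)
  also have "\<dots> \<le> ennreal (real CARD('n) * 2 ^ CARD('n)) * (ennreal (5 * 2 ^ CARD('n)) * N (cube x r))"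
    using dim r by (intro mult_left_mono dyadic_averages_le_lnorm measurable_norm) auto
  also have "\<dots> = ennreal (real CARD('n) * 2 ^ CARD('n) * (5 * 2 ^ CARD('n))) * N (cube x r)"
    by (rule ennreal_mult_assoc) auto
  also have "real CARD('n) * 2 ^ CARD('n) * (5 * 2 ^ CARD('n)) = mol_const CARD('n)"
    by (rule mol_const_eq)
  finally show ?thesis .
qed

text \<open>Dominated convergence over heights: at each height the d-th root of the level is at most
  the side of the cube, and the finite norm over the largest cube supplies the majorant. Continuity
  of the representative rests on this.\<close>

lemma lnorm_cube_tendsto_0:
  assumes "0 < c"
  shows "(\<lambda>k. N (cube x (c / Suc k))) \<longlonglongrightarrow> 0"
proof -
  let ?g = "\<lambda>x. norm (G x)"
  have [measurable]: "level ?g (cube x R) \<in> borel_measurable borel" for R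
    by (intro borel_measurable_level) auto
  let ?f = "\<lambda>R t. ennreal (level ?g (cube x R) t powr (1 / CARD('n))) * indicator {0<..} t"
  have "(\<lambda>k. \<integral>\<^sup>+ t. ?f (c / Suc k) t \<partial>lborel) \<longlonglongrightarrow> (\<integral>\<^sup>+ t. 0 \<partial>(lborel :: real measure))"
  proof (rule nn_integral_dominated_convergence[where w = "?f c"])
    show "(\<integral>\<^sup>+ t. ?f c t \<partial>lborel) < \<infinity>"
      using lnorm_finite[of "cube x c"] by (simp add: lnorm_def)
    show "AE t in lborel. ?f (c / Suc k) t \<le> ?f c t" for k
    proof (rule AE_I2, intro mult_right_mono ennreal_leI powr_mono2 level_mono)
      have "c / Suc k \<le> c" using assms by (simp add: divide_simps)
      then show "cube x (c / Suc k) \<subseteq> cube x c" by (meson mem_cube order_trans subsetI)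
    qed auto
    show "AE t in lborel. (\<lambda>k. ?f (c / Suc k) t) \<longlonglongrightarrow> 0"
    proof (rule AE_I2)
      fix t :: real
      have bd: "level ?g (cube x (c / Suc k)) t powr (1 / CARD('n)) \<le> 2 * (c / Suc k)" for k
      proof -
        have "level ?g (cube x (c / Suc k)) t \<le> (2 * (c / Suc k)) ^ CARD('n)"
          using level_le_measure[of ?g "cube x (c / Suc k)" t] assms by (simp add: measure_cube)
        then have "level ?g (cube x (c / Suc k)) t powr (1 / CARD('n)) \<le> ((2 * (c / Suc k)) ^ CARD('n)) powr (1 / CARD('n))"
          by (intro powr_mono2) auto
        also have "\<dots> = 2 * (c / Suc k)"
          using assms by (simp add: powr_realpow[symmetric] powr_powr del: powr_realpow)
        finally show ?thesis .
      qed
      have "(\<lambda>k. 2 * (c / Suc k)) \<longlonglongrightarrow> 0"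
        by (intro tendsto_mult_right_zero LIMSEQ_Suc[OF lim_const_over_n])
      then have "(\<lambda>k. level ?g (cube x (c / Suc k)) t powr (1 / CARD('n))) \<longlonglongrightarrow> 0"
        by (rule tendsto_sandwich[rotated 2, OF tendsto_const]) (intro always_eventually allI bd powr_ge_zero)+
      then have "(\<lambda>k. ennreal (level ?g (cube x (c / Suc k)) t powr (1 / CARD('n)))) \<longlonglongrightarrow> ennreal 0"
        by (rule tendsto_ennrealI)
      then show "(\<lambda>k. ?f (c / Suc k) t) \<longlonglongrightarrow> 0" by (cases "0 < t") auto
    qed
  qed auto
  then show ?thesis by (simp add: lnorm_def)
qed

lemma lnorm_cube_mono: "r \<le> s \<Longrightarrow> N (cube x r) \<le> N (cube x s)"
  by (intro lnorm_mono measurable_norm cube_mono) auto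

lemma lnorm_cube_small:
  assumes "0 < e" "0 \<le> C"
  obtains r where "0 < r" "ennreal C * N (cube x r) < ennreal e"
proof -
  have "(\<lambda>k. ennreal C * N (cube x (1 / Suc k))) \<longlonglongrightarrow> ennreal C * 0"
    by (intro ennreal_tendsto_cmult lnorm_cube_tendsto_0) auto
  then have "\<forall>\<^sub>F k in sequentially. ennreal C * N (cube x (1 / Suc k)) < ennreal e"
    by (rule order_tendstoD(2)) (use assms in auto)
  then obtain k where "ennreal C * N (cube x (1 / Suc k)) < ennreal e"
    by (auto dest: eventually_happens)
  then show thesis by (rule that[rotated]) simp
qed

text \<open>The limit exists by \<open>mol_tendsto_rep\<close>. It is \<open>mass\<close> times the
  continuous representative; \<open>continuous_rep_A\<close> divides by that constant.\<close>

definition rep :: "real^'n \<Rightarrow> complex" where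
  "rep x = lim (\<lambda>k. mol x (1 / Suc k))"

lemma mol_tendsto_rep: "(\<lambda>k. mol x (1 / Suc k)) \<longlonglongrightarrow> rep x"
proof -
  have "Cauchy (\<lambda>k. mol x (1 / Suc k))"
  proof (rule metric_CauchyI)
    fix e :: real assume "0 < e"
    then obtain r where r: "0 < r" "ennreal (mol_const CARD('n)) * N (cube x r) < ennreal (e / 2)"
      using lnorm_cube_small[of "e / 2" "mol_const CARD('n)" x] mol_const_nonneg by auto
    obtain K where K: "inverse (real (Suc K)) < r" using reals_Archimedean[OF r(1)] by blast
    have "dist (mol x (1 / Suc k)) (mol x r) < e / 2" if "K \<le> k" for k
    proof -
      have "1 / Suc k \<le> 1 / Suc K" using that by (simp add: divide_simps)
      then have "1 / Suc k \<le> r" using K by (simp add: inverse_eq_divide)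
      then have "ennreal (norm (mol x (1 / Suc k) - mol x r)) \<le> ennreal (mol_const CARD('n)) * N (cube x r)"
        by (intro mol_le) auto
      with r(2) have "ennreal (norm (mol x (1 / Suc k) - mol x r)) < ennreal (e / 2)" by (rule le_less_trans[rotated])
      then show ?thesis by (simp add: ennreal_less_iff dist_norm)
    qed
    then show "\<exists>K. \<forall>m\<ge>K. \<forall>n\<ge>K. dist (mol x (1 / Suc m)) (mol x (1 / Suc n)) < e"
      by (intro exI[of _ K]) (blast intro: dist_triangle_half_l)
  qed
  then show ?thesis
    unfolding rep_def by (simp add: Cauchy_convergent_iff convergent_LIMSEQ_iff)
qed

lemma rep_mol_le:
  assumes "0 < r"
  shows "ennreal (norm (rep x - mol x r)) \<le> ennreal (mol_const CARD('n)) * N (cube x r)"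
proof (rule tendsto_upperbound)
  show "(\<lambda>k. ennreal (norm (mol x (1 / Suc k) - mol x r))) \<longlonglongrightarrow> ennreal (norm (rep x - mol x r))"
    by (intro tendsto_intros mol_tendsto_rep)
  have "(\<lambda>k. 1 / real (Suc k)) \<longlonglongrightarrow> 0" by (rule LIMSEQ_Suc[OF lim_const_over_n])
  then have "\<forall>\<^sub>F k in sequentially. 1 / real (Suc k) < r" using assms by (rule order_tendstoD(2))
  then show "\<forall>\<^sub>F k in sequentially. ennreal (norm (mol x (1 / Suc k) - mol x r)) \<le> ennreal (mol_const CARD('n)) * N (cube x r)"
    by eventually_elim (intro mol_le, auto)
qed auto

text \<open>Path from \<open>rep y\<close> to \<open>mol y r\<close>, \<open>mol x r\<close> and
  \<open>rep x\<close>. Each of the three moves costs \<open>mol_const\<close> times the norm over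
  the cube of half-side 2r at \<open>x\<close>, which contains the cube of half-side r at
  \<open>y\<close>.\<close>

lemma rep_diff_le:
  assumes r: "0 < r" and xy: "\<And>i. \<bar>y $ i - x $ i\<bar> \<le> r"
  shows "ennreal (norm (rep y - rep x)) \<le> ennreal (3 * mol_const CARD('n)) * N (cube x (2 * r))"
proof -
  let ?d = "CARD('n)"
  let ?N = "N (cube x (2 * r))"
  have "cube y r \<subseteq> cube x (2 * r)" by (rule cube_shift_subset[OF xy])
  then have "N (cube y r) \<le> ?N" by (intro lnorm_mono measurable_norm) auto
  then have 1: "ennreal (norm (rep y - mol y r)) \<le> ennreal (mol_const ?d) * ?N"
    by (intro order_trans[OF rep_mol_le[OF r]] mult_left_mono) auto
  have "N (cube x r) \<le> ?N" using r by (intro lnorm_cube_mono) auto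
  then have 3: "ennreal (norm (mol x r - rep x)) \<le> ennreal (mol_const ?d) * ?N"
    unfolding norm_minus_commute[of "mol x r"]
    by (intro order_trans[OF rep_mol_le[OF r]] mult_left_mono) auto
  have "ennreal (norm (mol y r - mol x r)) \<le> ennreal (2 * real ?d * (1 / r) ^ (?d - 1)) * I x (2 * r)"
    unfolding mol_def using r xy by (intro bavg_change[OF weak measurable_norm]) auto
  \<comment> \<open>Rewritten at scale 2r, the move of the centre becomes the first summand of the
    dyadic sum for 2r, so \<open>dyadic_averages_le_lnorm\<close> with one term bounds it.\<close>
  also have "2 * real ?d * (1 / r) ^ (?d - 1) = real ?d * 2 ^ ?d * (1 / (2 * r)) ^ (?d - 1)"
    using dim by (cases ?d) (auto simp: power_divide power_mult_distrib)
  also have "ennreal \<dots> * I x (2 * r) = ennreal (real ?d * 2 ^ ?d) * (ennreal ((1 / (2 * r)) ^ (?d - 1)) * I x (2 * r))"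
    using r by (subst ennreal_mult_assoc) auto
  also have "\<dots> \<le> ennreal (real ?d * 2 ^ ?d) * (ennreal (5 * 2 ^ ?d) * ?N)"
    using dyadic_averages_le_lnorm[OF dim measurable_norm, of "2 * r" x 1] r
    by (intro mult_left_mono) simp_all
  also have "\<dots> = ennreal (mol_const ?d) * ?N"
    by (subst ennreal_mult_assoc) (simp_all only: mol_const_eq, auto)
  finally have 2: "ennreal (norm (mol y r - mol x r)) \<le> ennreal (mol_const ?d) * ?N" .
  have "rep y - rep x = (rep y - mol y r) + ((mol y r - mol x r) + (mol x r - rep x))" by simp
  then have "ennreal (norm (rep y - rep x))
      \<le> ennreal (norm (rep y - mol y r)) + (ennreal (norm (mol y r - mol x r)) + ennreal (norm (mol x r - rep x)))"
    by (simp only:) (intro order_trans[OF ennreal_norm_triangle] add_left_mono ennreal_norm_triangle)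
  also have "\<dots> \<le> ennreal (mol_const ?d) * ?N + (ennreal (mol_const ?d) * ?N + ennreal (mol_const ?d) * ?N)"
    by (intro add_mono 1 2 3)
  also have "\<dots> = ennreal (3 * mol_const ?d) * ?N"
  proof -
    have "ennreal (3 * mol_const ?d) = ennreal (mol_const ?d) + (ennreal (mol_const ?d) + ennreal (mol_const ?d))"
      using mol_const_nonneg[of ?d] by (simp add: ennreal_plus[symmetric] del: ennreal_plus)
    then show ?thesis by (simp add: distrib_right)
  qed
  finally show ?thesis .
qed

lemma continuous_rep_fun: "continuous_on UNIV rep"
proof (rule continuous_at_imp_continuous_on, rule ballI)
  fix x
  show "isCont rep x"
    unfolding continuous_at_eps_delta
  proof (intro allI impI)
    fix e :: real assume "0 < e"
    then obtain r where r: "0 < r" "ennreal (3 * mol_const CARD('n)) * N (cube x r) < ennreal e"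
      using lnorm_cube_small[of e "3 * mol_const CARD('n)" x] mol_const_nonneg by auto
    show "\<exists>d>0. \<forall>y. dist y x < d \<longrightarrow> dist (rep y) (rep x) < e"
    proof (intro exI[of _ "r / 2"] conjI allI impI)
      fix y assume y: "dist y x < r / 2"
      have "\<bar>y $ i - x $ i\<bar> \<le> r / 2" for i
        using component_le_norm_cart[of "y - x" i] y by (simp add: dist_norm)
      with rep_diff_le[of "r / 2" y x] r have "ennreal (norm (rep y - rep x)) < ennreal e" by auto
      then show "dist (rep y) (rep x) < e" by (simp add: ennreal_less_iff dist_norm)
    qed (use r in auto)
  qed
qed

end

section \<open>Identification of the limit with a multiple of \<open>A\<close> almost
  everywhere\<close>

definition mass :: "'n::finite itself \<Rightarrow> real" where
  "mass _ = (LINT z|lebesgue. boxbump (\<lambda>_::'n. 0) (\<lambda>_. 1) z)"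

lemma borel_measurable_boxbump [measurable]: "boxbump a s \<in> borel_measurable borel"
  by (intro borel_measurable_continuous_onI continuous_boxbump)

lemma boxbump_bound:
  fixes z :: "real^'n::finite"
  assumes "0 < r"
  shows "boxbump a (\<lambda>_. r) z \<le> (1 / r) ^ CARD('n)"
proof -
  have "boxbump a (\<lambda>_. r) z \<le> (\<Prod>i\<in>(UNIV :: 'n set). 1 / r)"
    unfolding boxbump_def prodfun_def using assms
    by (intro prod_mono conjI divide_right_mono bump_le_1 divide_nonneg_pos bump_nonneg) auto
  then show ?thesis by simp
qed

lemma integrable_boxbump_real:
  assumes "\<And>i. 0 < s i"
  shows "integrable lebesgue (boxbump a s)"
proof -
  have "locally_integrable (\<lambda>_. 1 :: real)"
    unfolding locally_integrable_def set_integrable_def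
    using lmeasurable_compact by (auto simp: lmeasurable_iff_integrable)
  from integrable_scaleR_local[OF this continuous_boxbump, of "cube (\<chi> i. a i) (\<Sum>i\<in>UNIV. s i)" a s]
  moreover have "s i \<le> (\<Sum>i\<in>UNIV. s i)" for i
    using assms by (intro member_le_sum) (auto intro: less_imp_le)
  ultimately show ?thesis
    using boxbump_support[of s a "\<chi> i. a i" "\<Sum>i\<in>UNIV. s i"] assms by simp
qed

text \<open>Under translation and dilation the Jacobian r^d cancels the d factors 1/r. The common
  value depends on the dimension alone, so \<open>mass\<close> takes only the index type as its
  argument.\<close>

lemma integral_boxbump:
  fixes a :: "'n::finite \<Rightarrow> real"
  assumes r: "0 < r"
  shows "(LINT z|lebesgue. boxbump a (\<lambda>_. r) z) = mass TYPE('n)"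
proof -
  let ?T = "\<lambda>z::real^'n. (\<chi> i. a i) + r *\<^sub>R z"
  have "(LINT z|lebesgue. boxbump a (\<lambda>_. r) z) = (LINT z|lborel. boxbump a (\<lambda>_. r) z)"
    by (intro integral_completion) measurable
  also have "\<dots> = (LINT z|density (distr lborel borel ?T) (\<lambda>_. ennreal (\<bar>r\<bar> ^ DIM(real^'n))). boxbump a (\<lambda>_. r) z)"
    using r by (subst lborel_affine[of r "\<chi> i. a i"]) auto
  also have "\<dots> = (LINT z|lborel. \<bar>r\<bar> ^ DIM(real^'n) * boxbump a (\<lambda>_. r) (?T z))"
    by (subst integral_density) (auto simp: integral_distr)
  also have "\<dots> = (LINT z|lborel. boxbump (\<lambda>_::'n. 0) (\<lambda>_. 1) z)"
  proof (rule Bochner_Integration.integral_cong[OF refl])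
    fix z :: "real^'n"
    have "\<bar>r\<bar> ^ DIM(real^'n) = (\<Prod>i\<in>(UNIV :: 'n set). r)" using r by simp
    then show "\<bar>r\<bar> ^ DIM(real^'n) * boxbump a (\<lambda>_. r) (?T z) = boxbump (\<lambda>_. 0) (\<lambda>_. 1) z"
      unfolding boxbump_def prodfun_def using r
      by (simp only: prod.distrib[symmetric]) (auto intro!: prod.cong)
  qed
  also have "\<dots> = mass TYPE('n)"
    unfolding mass_def by (intro integral_completion[symmetric]) measurable
  finally show ?thesis .
qed

lemma mass_pos: "0 < mass TYPE('n::finite)"
proof -
  let ?f = "boxbump (\<lambda>_::'n. 0) (\<lambda>_. 1)"
  have nonneg: "0 \<le> ?f z" for z by (rule boxbump_nonneg) simp
  have int: "integrable lebesgue ?f" by (rule integrable_boxbump_real) simp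
  have "mass TYPE('n) \<noteq> 0"
  proof
    assume "mass TYPE('n) = 0"
    then have "AE z in lebesgue. ?f z = 0"
      using integral_nonneg_eq_0_iff_AE[OF int] nonneg by (simp add: mass_def)
    then obtain Z where Z: "Z \<in> null_sets lebesgue" "\<And>z. z \<notin> Z \<Longrightarrow> ?f z = 0"
      by (elim AE_E3) auto
    have "cube 0 (1/2) \<subseteq> Z"
    proof
      fix z :: "real^'n" assume "z \<in> cube 0 (1/2)"
      then have "\<bar>z $ i\<bar> \<le> 1 / 2" for i by (simp add: mem_cube)
      then have "\<bar>z $ i\<bar> < 1" for i by (rule le_less_trans) simp
      then have "0 < bump (z $ i)" for i by (rule bump_pos)
      then have "0 < ?f z" unfolding boxbump_def prodfun_def by (intro prod_pos) auto
      then show "z \<in> Z" using Z(2)[of z] by (cases "z \<in> Z") auto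
    qed
    with Z(1) have "negligible (cube (0::real^'n) (1/2))"
      by (metis negligible_iff_null_sets negligible_subset)
    then have "measure lebesgue (cube (0::real^'n) (1/2)) = 0" by (rule negligible_imp_measure0)
    then show False by (simp add: measure_cube)
  qed
  moreover have "0 \<le> mass TYPE('n)" unfolding mass_def by (intro Bochner_Integration.integral_nonneg nonneg)
  ultimately show ?thesis by simp
qed

text \<open>\<open>integrable_ccontinuous_explicit\<close> differentiates integrals along cubes with
  a corner at \<open>x\<close>. Such a cube is centred at x + r(1,...,1), so \<open>AE_rep\<close>
  works with averages at this shifted centre.\<close>

lemma cbox_One_eq_cube: "cbox x (x + (2 * r) *\<^sub>R One) = cube (x + r *\<^sub>R One :: real^'n::finite) r"
proof -
  have "(One :: real^'n) $ i = 1" for i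
    by (simp add: cart_eq_inner_axis inner_sum_left_Basis axis_in_Basis_iff)
  then show ?thesis by (auto simp: mem_cube mem_box_cart abs_le_iff algebra_simps)
qed

context weak_gradient
begin

lemma locally_integrable_A: "locally_integrable A"
  using weak by (simp add: has_weak_gradient_def)

lemma set_integrable_norm_diff:
  assumes "compact K"
  shows "set_integrable lebesgue K (\<lambda>z. norm (A z - q))"
proof -
  have "set_integrable lebesgue K (\<lambda>z. q)"
    using lmeasurable_compact[OF assms]
    by (auto simp: set_integrable_def fmeasurable_def)
  moreover have "set_integrable lebesgue K A"
    using locally_integrable_A assms by (simp add: locally_integrable_def)
  ultimately show ?thesis by (intro set_integrable_norm set_integral_diff)
qed

text \<open>The bump integrates the constant \<open>q\<close> to \<open>mass\<close> times
  \<open>q\<close>, is supported in the cube and is at most r^(-d).\<close>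

lemma mol_diff_const_le:
  assumes r: "0 < r"
  shows "norm (mol y r - mass TYPE('n) *\<^sub>R q) \<le> (1 / r) ^ CARD('n) * integral (cube y r) (\<lambda>z. norm (A z - q))"
proof -
  let ?\<phi> = "boxbump (\<lambda>i. y $ i) (\<lambda>_. r)"
  have \<phi>0: "0 \<le> ?\<phi> z" for z by (rule boxbump_nonneg) (rule r)
  have int: "integrable lebesgue (\<lambda>z. ?\<phi> z *\<^sub>R A z)" "integrable lebesgue (\<lambda>z. ?\<phi> z *\<^sub>R q)"
    using r by (auto intro!: integrable_boxbump locally_integrable_A integrable_scaleR_left integrable_boxbump_real)
  have intK: "set_integrable lebesgue (cube y r) (\<lambda>z. norm (A z - q))"
    by (rule set_integrable_norm_diff) simp
  have "mol y r - mass TYPE('n) *\<^sub>R q = (LINT z|lebesgue. ?\<phi> z *\<^sub>R (A z - q))"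
    using integral_boxbump[OF r, of "\<lambda>i. y $ i"] int r
    by (simp add: mol_def bavg_def scaleR_diff_right integral_scaleR_left integrable_boxbump_real)
  also have "norm \<dots> \<le> (LINT z|lebesgue. norm (?\<phi> z *\<^sub>R (A z - q)))"
    by (rule integral_norm_bound)
  also have "\<dots> \<le> (LINT z|lebesgue. (1 / r) ^ CARD('n) * (indicator (cube y r) z *\<^sub>R norm (A z - q)))"
  proof (rule integral_mono)
    show "integrable lebesgue (\<lambda>z. norm (?\<phi> z *\<^sub>R (A z - q)))"
      using int by (simp add: scaleR_diff_right)
    show "integrable lebesgue (\<lambda>z. (1 / r) ^ CARD('n) * (indicator (cube y r) z *\<^sub>R norm (A z - q)))"
      using intK by (simp add: set_integrable_def)
    fix z
    show "norm (?\<phi> z *\<^sub>R (A z - q)) \<le> (1 / r) ^ CARD('n) * (indicator (cube y r) z *\<^sub>R norm (A z - q))"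
    proof (cases "z \<in> cube y r")
      case True
      then show ?thesis using boxbump_bound[OF r, of "\<lambda>i. y $ i" z] \<phi>0[of z] by (auto intro: mult_right_mono)
    next
      case False
      then have "?\<phi> z = 0" using r by (intro boxbump_support[of _ _ y r]) auto
      then show ?thesis using r by simp
    qed
  qed
  also have "\<dots> = (1 / r) ^ CARD('n) * (LINT z:cube y r|lebesgue. norm (A z - q))"
    by (simp add: set_lebesgue_integral_def)
  also have "(LINT z:cube y r|lebesgue. norm (A z - q)) = integral (cube y r) (\<lambda>z. norm (A z - q))"
    by (rule set_lebesgue_integral_eq_integral(2)[OF intK])
  finally show ?thesis .
qed

text \<open>The Lebesgue point argument: |A - q| is differentiated for every \<open>q\<close> in a
  countable dense set, so the exceptional sets have a negligible union. The bumps sit at a centre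
  \<open>?y\<close> at sup-distance at most r from \<open>x\<close>, and \<open>rep_diff_le\<close>
  returns from \<open>?y\<close> to \<open>x\<close>.\<close>

lemma AE_rep: "AE x in lebesgue. rep x = mass TYPE('n) *\<^sub>R A x"
proof -
  let ?M = "mass TYPE('n)"
  obtain D :: "complex set" where D: "countable D" "\<And>X. open X \<Longrightarrow> X \<noteq> {} \<Longrightarrow> \<exists>d\<in>D. d \<in> X"
    by (rule countable_dense_setE) blast
  let ?f = "\<lambda>q z. norm (A z - q)"
  define P where "P q Z \<longleftrightarrow> negligible Z \<and> (\<forall>x e. x \<notin> Z \<longrightarrow> 0 < e \<longrightarrow> (\<exists>\<delta>>0. \<forall>h. 0 < h \<and> h < \<delta> \<longrightarrow>
      norm (integral (cbox x (x + h *\<^sub>R One)) (?f q) /\<^sub>R h ^ DIM(real^'n) - ?f q x) < e))" for q Z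
  have "\<exists>Z. P q Z" for q
  proof -
    have "?f q integrable_on cbox a b" for a b
      by (rule set_lebesgue_integral_eq_integral(1)[OF set_integrable_norm_diff]) simp
    then show ?thesis
      by (rule integrable_ccontinuous_explicit) (unfold P_def, blast)
  qed
  then obtain Z where "\<And>q. P q (Z q)" by metis
  then have Z: "\<And>q. negligible (Z q)"
    "\<And>q x e. x \<notin> Z q \<Longrightarrow> 0 < e \<Longrightarrow> \<exists>\<delta>>0. \<forall>h. 0 < h \<and> h < \<delta> \<longrightarrow>
      norm (integral (cbox x (x + h *\<^sub>R One)) (?f q) /\<^sub>R h ^ DIM(real^'n) - ?f q x) < e"
    unfolding P_def by blast+
  have "rep x = ?M *\<^sub>R A x" if x: "\<And>q. q \<in> D \<Longrightarrow> x \<notin> Z q" for x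
  proof -
    let ?K = "2 + 2 ^ CARD('n) * 2 + ?M"
    have bound: "norm (rep x - ?M *\<^sub>R A x) \<le> ?K * e" if e: "0 < e" for e
    proof -
      obtain q where q: "q \<in> D" "norm (A x - q) < e"
        using D(2)[of "ball (A x) e"] e by (auto simp: dist_norm)
      obtain \<delta> where \<delta>: "0 < \<delta>" "\<And>h. 0 < h \<Longrightarrow> h < \<delta> \<Longrightarrow>
          norm (integral (cbox x (x + h *\<^sub>R One)) (?f q) /\<^sub>R h ^ DIM(real^'n) - ?f q x) < e"
        using Z(2)[OF x[OF q(1)] e] by blast
      obtain r0 where r0: "0 < r0" "ennreal (3 * mol_const CARD('n)) * N (cube x r0) < ennreal e"
        using lnorm_cube_small[of e "3 * mol_const CARD('n)" x] mol_const_nonneg e by auto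
      define r where "r = min \<delta> r0 / 4"
      have r: "0 < r" "2 * r < \<delta>" "2 * r \<le> r0" using \<delta>(1) r0(1) by (auto simp: r_def min_def)
      let ?y = "x + r *\<^sub>R One"
      have x_y: "\<bar>?y $ i - x $ i\<bar> \<le> r" for i
      proof -
        have "x \<in> cbox x (x + (2 * r) *\<^sub>R One)" using r by (simp add: mem_box inner_add_left)
        then show ?thesis unfolding cbox_One_eq_cube mem_cube by (metis abs_minus_commute)
      qed
      have small: "ennreal (3 * mol_const CARD('n)) * N (cube x (2 * r)) < ennreal e"
        using r0(2) lnorm_cube_mono[OF r(3), of x] by (meson le_less_trans mult_left_mono zero_le)
      have 1: "norm (rep ?y - rep x) < e"
        using rep_diff_le[OF r(1) x_y] small by (auto simp: ennreal_less_iff dest: le_less_trans)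
      have "cube ?y r \<subseteq> cube x (2 * r)" by (rule cube_shift_subset[OF x_y])
      then have "N (cube ?y r) \<le> N (cube x (2 * r))" by (intro lnorm_mono measurable_norm) auto
      then have "ennreal (mol_const CARD('n)) * N (cube ?y r) \<le> ennreal (3 * mol_const CARD('n)) * N (cube x (2 * r))"
        using mol_const_nonneg[of "CARD('n)"] by (intro mult_mono ennreal_leI) auto
      then have "ennreal (norm (rep ?y - mol ?y r)) < ennreal e"
        using rep_mol_le[OF r(1), of ?y] small by (meson le_less_trans order_trans)
      then have 2: "norm (rep ?y - mol ?y r) < e" by (simp add: ennreal_less_iff)
      have "norm (mol ?y r - ?M *\<^sub>R q) \<le> (1 / r) ^ CARD('n) * integral (cube ?y r) (?f q)"
        by (rule mol_diff_const_le[OF r(1)])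
      \<comment> \<open>The factor 2^d appears because the mean is over a cube of side 2r, while the
        bump bound is r^(-d).\<close>
      also have "\<dots> = 2 ^ CARD('n) * (integral (cbox x (x + (2 * r) *\<^sub>R One)) (?f q) /\<^sub>R (2 * r) ^ DIM(real^'n))"
        unfolding cbox_One_eq_cube using r(1) by (simp add: power_mult_distrib power_divide field_simps)
      \<comment> \<open>The mean of |A - q| is within e of |A x - q|, which is itself below
        e.\<close>
      also have "\<dots> \<le> 2 ^ CARD('n) * (2 * e)"
        using \<delta>(2)[of "2 * r"] r q(2) by (intro mult_left_mono) auto
      finally have 3: "norm (mol ?y r - ?M *\<^sub>R q) \<le> 2 ^ CARD('n) * (2 * e)" .
      have "norm (?M *\<^sub>R q - ?M *\<^sub>R A x) = ?M * norm (A x - q)"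
        using mass_pos[where 'n = 'n] by (simp add: scaleR_diff_right[symmetric] norm_minus_commute)
      also have "\<dots> \<le> ?M * e" using q(2) mass_pos[where 'n = 'n] by (intro mult_left_mono) auto
      finally have 4: "norm (?M *\<^sub>R q - ?M *\<^sub>R A x) \<le> ?M * e" .
      have "rep x - ?M *\<^sub>R A x = (rep x - rep ?y) + ((rep ?y - mol ?y r)
          + ((mol ?y r - ?M *\<^sub>R q) + (?M *\<^sub>R q - ?M *\<^sub>R A x)))" by simp
      also have "norm \<dots> \<le> e + (e + (2 ^ CARD('n) * (2 * e) + ?M * e))"
        by (intro norm_triangle_mono 3 4) (use 1 2 in \<open>auto simp: norm_minus_commute\<close>)
      finally show ?thesis by (simp add: algebra_simps)
    qed
    have K: "0 < ?K" using mass_pos[where 'n = 'n] by (simp add: add_pos_pos)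
    have "norm (rep x - ?M *\<^sub>R A x) \<le> 0 + e" if "0 < e" for e
    proof -
      have "?K * (e / ?K) = e" using K by simp
      with bound[of "e / ?K"] that K show ?thesis by (metis add_0 divide_pos_pos)
    qed
    then have "norm (rep x - ?M *\<^sub>R A x) \<le> 0" by (rule field_le_epsilon)
    then show ?thesis by simp
  qed
  then have "{x. rep x \<noteq> ?M *\<^sub>R A x} \<subseteq> (\<Union>q\<in>D. Z q)" by blast
  moreover have "negligible (\<Union>q\<in>D. Z q)"
    using D(1) Z(1) by (auto intro!: null_sets_UN' simp: negligible_iff_null_sets)
  ultimately have "negligible {x. rep x \<noteq> ?M *\<^sub>R A x}" by (rule negligible_subset[rotated])
  then show ?thesis by (intro AE_I'[where N = "{x. rep x \<noteq> ?M *\<^sub>R A x}"]) (auto simp: negligible_iff_null_sets)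
qed

end

text \<open>An open negligible set is empty. This makes the definite description in
  \<open>continuous_rep\<close> single-valued.\<close>

lemma continuous_AE_unique:
  fixes f g :: "'a::euclidean_space \<Rightarrow> 'b::real_normed_vector"
  assumes "continuous_on UNIV f" "continuous_on UNIV g" "AE x in lebesgue. f x = g x"
  shows "f = g"
proof -
  have "open {x. f x \<noteq> g x}" by (rule open_Collect_neq) (rule assms)+
  moreover have "{x. f x \<noteq> g x} \<in> null_sets lebesgue"
    using assms(3) by (auto simp: eventually_ae_filter negligible_iff_null_sets[symmetric] intro: negligible_subset)
  ultimately have "{x. f x \<noteq> g x} = {}"
    using open_not_negligible negligible_iff_null_sets by blast
  then show ?thesis by auto
qed

lemma continuous_rep_eq:
  assumes "continuous_on UNIV B" "AE x in lebesgue. B x = A x"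
  shows "continuous_rep A = B"
  unfolding continuous_rep_def
proof (rule the_equality)
  fix B' assume B': "continuous_on UNIV B' \<and> (AE x in lebesgue. B' x = A x)"
  then have "AE x in lebesgue. B' x = A x" by simp
  with assms(2) have "AE x in lebesgue. B' x = B x" by eventually_elim simp
  then show "B' = B" using B' assms(1) by (intro continuous_AE_unique) auto
qed (use assms in simp)

context weak_gradient
begin

lemma continuous_rep_A: "continuous_rep A = (\<lambda>x. (1 / mass TYPE('n)) *\<^sub>R rep x)"
proof (rule continuous_rep_eq)
  show "AE x in lebesgue. (1 / mass TYPE('n)) *\<^sub>R rep x = A x"
    using AE_rep by eventually_elim (use mass_pos[where 'n = 'n] in simp)
qed (intro continuous_intros continuous_rep_fun)

lemma continuous_rep_diff_le:
  assumes "h \<noteq> 0"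
  shows "ennreal (norm (continuous_rep A (x + h) - continuous_rep A x))
    \<le> ennreal (3 * mol_const CARD('n) / mass TYPE('n)) * N (cube x (2 * norm h))"
proof -
  let ?M = "mass TYPE('n)"
  have M: "0 < ?M" by (rule mass_pos)
  have "ennreal (norm (continuous_rep A (x + h) - continuous_rep A x))
      = ennreal (1 / ?M) * ennreal (norm (rep (x + h) - rep x))"
    using M by (simp add: continuous_rep_A scaleR_diff_right[symmetric] ennreal_mult[symmetric])
  also have "\<dots> \<le> ennreal (1 / ?M) * (ennreal (3 * mol_const CARD('n)) * N (cube x (2 * norm h)))"
    using assms component_le_norm_cart[of h] by (intro mult_left_mono rep_diff_le) auto
  also have "\<dots> = ennreal (3 * mol_const CARD('n) / ?M) * N (cube x (2 * norm h))"
    using M mol_const_nonneg[of "CARD('n)"] by (subst ennreal_mult_assoc) auto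
  finally show ?thesis .
qed

end

section \<open>Comparison with the Lorentz norm\<close>

text \<open>The integrand is the kernel of \<open>lorentz_norm\<close>. Inserting this for the power
  of the level turns \<open>lnorm\<close> into a double integral over heights and measures.\<close>

lemma nn_integral_powr:
  fixes m p :: real
  assumes "0 \<le> m" "0 < p"
  shows "ennreal (m powr p) = (\<integral>\<^sup>+ s. ennreal (p * (s powr p / s)) * indicator {0<..<m} s \<partial>lborel)"
proof -
  have "((\<lambda>s. p * s powr (p - 1)) has_integral (p * (m powr (p - 1 + 1) / (p - 1 + 1)))) {0..m}"
    using assms by (intro has_integral_mult_right has_integral_powr_from_0) auto
  then have "((\<lambda>s. p * s powr (p - 1)) has_integral (m powr p)) {0..m}" using assms by simp
  then have "ennreal (m powr p) = (\<integral>\<^sup>+ s. ennreal (indicator {0..m} s * (p * s powr (p - 1))) \<partial>lborel)"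
    using assms(2) by (intro nn_integral_has_integral_lebesgue[symmetric]) auto
  also have "\<dots> = (\<integral>\<^sup>+ s. ennreal (p * (s powr p / s)) * indicator {0<..<m} s \<partial>lborel)"
  proof (rule nn_integral_cong_AE)
    have "AE s in lborel. s \<noteq> 0 \<and> s \<noteq> m" using AE_lborel_singleton[of 0] AE_lborel_singleton[of m] by eventually_elim simp
    then show "AE s in lborel. ennreal (indicator {0..m} s * (p * s powr (p - 1)))
        = ennreal (p * (s powr p / s)) * indicator {0<..<m} s"
      by eventually_elim (auto simp: indicator_def powr_diff)
  qed
  finally show ?thesis .
qed

text \<open>For u < t the set where |g| > u contains the level set, hence has measure above
  \<open>s\<close>; so no such u is admissible in the infimum.\<close>

lemma level_less_decreasing_rearrangement:
  assumes g [measurable]: "g \<in> borel_measurable lebesgue" and S: "S \<in> lmeasurable" and g0: "\<And>x. 0 \<le> g x"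
    and s: "0 < s" "s < level g S t"
  shows "ennreal t \<le> decreasing_rearrangement g s"
  unfolding decreasing_rearrangement_def
proof (rule Inf_greatest, rule ccontr)
  fix u assume "u \<in> {u. emeasure lebesgue {x. u < ennreal \<bar>g x\<bar>} \<le> ennreal s}" "\<not> ennreal t \<le> u"
  then have u: "emeasure lebesgue {x. u < ennreal \<bar>g x\<bar>} \<le> ennreal s" "u < ennreal t" by auto
  have "{x \<in> space lebesgue. u < ennreal \<bar>g x\<bar>} \<in> sets lebesgue" by measurable
  then have meas: "{x. u < ennreal \<bar>g x\<bar>} \<in> sets lebesgue" by simp
  have "{x \<in> S. t < g x} \<subseteq> {x. u < ennreal \<bar>g x\<bar>}"
    using u(2) g0 by (auto intro: less_le_trans ennreal_leI)
  then have "ennreal (level g S t) \<le> emeasure lebesgue {x. u < ennreal \<bar>g x\<bar>}"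
    unfolding emeasure_level[OF g S, symmetric] by (rule emeasure_mono) (rule meas)
  with u(1) have "ennreal (level g S t) \<le> ennreal s" by simp
  with s show False by simp
qed

text \<open>Tonelli on the region 0 < s < level(t): integrating first in s gives
  \<open>lnorm\<close>, while for fixed s the admissible heights t lie below the rearrangement at
  s.\<close>

lemma lnorm_le_lorentz_norm:
  fixes g :: "real^'n::finite \<Rightarrow> real"
  assumes g: "g \<in> borel_measurable lebesgue" and S: "S \<in> lmeasurable" and g0: "\<And>x. 0 \<le> g x"
  shows "lnorm g S \<le> lorentz_norm (real CARD('n)) g"
proof -
  define p where "p = 1 / real CARD('n)"
  have p: "0 < p" by (simp add: p_def)
  have [measurable]: "level g S \<in> borel_measurable borel" by (rule borel_measurable_level[OF g S])
  let ?k = "\<lambda>s::real. ennreal (s powr p / s)"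
  let ?D = "\<lambda>s. {t. 0 < t \<and> 0 < s \<and> s < level g S t}"
  have D [measurable]: "Measurable.pred (borel \<Otimes>\<^sub>M borel) (\<lambda>(t, s). 0 < t \<and> 0 < s \<and> s < level g S t)"
    by measurable
  have "lnorm g S = (\<integral>\<^sup>+ t. (\<integral>\<^sup>+ s. ennreal p * (?k s * indicator (?D s) t) \<partial>lborel) \<partial>lborel)"
    unfolding lnorm_def
  proof (rule nn_integral_cong)
    fix t :: real
    have "ennreal (level g S t powr (1 / CARD('n))) * indicator {0<..} t
      = (\<integral>\<^sup>+ s. ennreal (p * (s powr p / s)) * indicator {0<..<level g S t} s \<partial>lborel) * indicator {0<..} t"
      using nn_integral_powr[OF level_nonneg p, of g S t] by (simp add: p_def)
    also have "\<dots> = (\<integral>\<^sup>+ s. ennreal (p * (s powr p / s)) * indicator {0<..<level g S t} s * indicator {0<..} t \<partial>lborel)"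
      by (intro nn_integral_multc[symmetric]) measurable
    also have "\<dots> = (\<integral>\<^sup>+ s. ennreal p * (?k s * indicator (?D s) t) \<partial>lborel)"
      using p by (intro nn_integral_cong) (auto simp: indicator_def ennreal_mult[symmetric])
    finally show "ennreal (level g S t powr (1 / CARD('n))) * indicator {0<..} t
      = (\<integral>\<^sup>+ s. ennreal p * (?k s * indicator (?D s) t) \<partial>lborel)" .
  qed
  also have "\<dots> = (\<integral>\<^sup>+ s. (\<integral>\<^sup>+ t. ennreal p * (?k s * indicator (?D s) t) \<partial>lborel) \<partial>lborel)"
  proof (rule lborel_pair.Fubini'[symmetric])
    have "(\<lambda>(t, s). ennreal p * (?k s * (if 0 < t \<and> 0 < s \<and> s < level g S t then 1 else 0)))
        \<in> borel_measurable (lborel \<Otimes>\<^sub>M lborel)"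
      by measurable
    then show "(\<lambda>(t, s). ennreal p * (?k s * indicator (?D s) t)) \<in> borel_measurable (lborel \<Otimes>\<^sub>M lborel)"
      by (simp add: indicator_def if_distrib cong: if_cong)
  qed
  also have "\<dots> = (\<integral>\<^sup>+ s. ennreal p * (?k s * emeasure lborel (?D s)) \<partial>lborel)"
    by (simp add: nn_integral_cmult)
  also have "\<dots> = ennreal p * (\<integral>\<^sup>+ s. ?k s * emeasure lborel (?D s) \<partial>lborel)"
    by (intro nn_integral_cmult) measurable
  also have "\<dots> \<le> ennreal p * (\<integral>\<^sup>+ s \<in> {0<..}. ?k s * decreasing_rearrangement g s \<partial>lborel)"
  proof (intro mult_left_mono nn_integral_mono)
    fix s :: real
    show "?k s * emeasure lborel (?D s) \<le> ?k s * decreasing_rearrangement g s * indicator {0<..} s"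
    proof (cases "0 < s")
      case True
      let ?u = "decreasing_rearrangement g s"
      have "emeasure lborel (?D s) \<le> ?u"
      proof (cases "?u = \<infinity>")
        case False
        then obtain u where u: "?u = ennreal u" "0 \<le> u" by (cases ?u) auto
        have "?D s \<subseteq> {0..u}"
        proof
          fix t assume "t \<in> ?D s"
          then have "ennreal t \<le> ?u" "0 < t"
            by (auto intro: level_less_decreasing_rearrangement[OF g S g0])
          then show "t \<in> {0..u}" using u by simp
        qed
        then have "emeasure lborel (?D s) \<le> emeasure lborel {0..u}" by (intro emeasure_mono) auto
        with u show ?thesis by simp
      qed simp
      with True show ?thesis by (simp add: mult_left_mono)
    qed simp
  qed simp
  also have "\<dots> = lorentz_norm (real CARD('n)) g"
    by (simp add: lorentz_norm_def p_def)
  finally show ?thesis .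
qed

section \<open>Superadditivity over disjoint sets\<close>

text \<open>Young's inequality for the exponents (n+1)/n and n+1. The induction step adds the
  rearrangement inequality (x^(n+1) - y^(n+1))(x - y) >= 0 to x times the hypothesis.\<close>

lemma weighted_power_mean:
  fixes x y :: real
  assumes "0 \<le> x" "0 \<le> y"
  shows "real (Suc n) * (x ^ n * y) \<le> real n * x ^ Suc n + y ^ Suc n"
proof (induction n)
  case (Suc n)
  have "0 \<le> (x ^ Suc n - y ^ Suc n) * (x - y)"
  proof (cases "x \<le> y")
    case True
    then show ?thesis using power_mono[OF True assms(1), of "Suc n"] by (intro mult_nonpos_nonpos) auto
  next
    case False
    then show ?thesis using power_mono[of y x "Suc n"] assms by (intro mult_nonneg_nonneg) auto
  qed
  moreover have "x * (real (Suc n) * (x ^ n * y)) \<le> x * (real n * x ^ Suc n + y ^ Suc n)"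
    by (intro mult_left_mono Suc.IH assms)
  ultimately show ?case by (simp add: algebra_simps)
qed simp

text \<open>Hoelder's inequality for the exponents (n+1)/n and n+1:
  \<open>weighted_power_mean\<close> for a/R and b/y, summed over \<open>J\<close>.\<close>

lemma discrete_Hoelder:
  fixes a b :: "'i \<Rightarrow> real"
  assumes "\<And>j. j \<in> J \<Longrightarrow> 0 \<le> a j" "\<And>j. j \<in> J \<Longrightarrow> 0 \<le> b j" "0 \<le> R" "0 \<le> y"
    and R: "(\<Sum>j\<in>J. a j ^ Suc n) = R ^ Suc n" and y: "(\<Sum>j\<in>J. b j ^ Suc n) \<le> y ^ Suc n"
  shows "(\<Sum>j\<in>J. a j ^ n * b j) \<le> R ^ n * y"
proof (cases "finite J")
  case fin: True
  show ?thesis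
  proof (cases "y = 0 \<or> R = 0")
    case True
    have zero: "a j ^ n * b j = 0" if "n \<noteq> 0 \<or> y = 0" "j \<in> J" for j
    proof (cases "y = 0")
      case True
      then have "b j ^ Suc n \<le> 0"
        using y member_le_sum[of j J "\<lambda>j. b j ^ Suc n"] that fin assms(2) by auto
      then show ?thesis using assms(2)[OF that(2)] by (metis less_le zero_less_power not_less mult_zero_right)
    next
      case False
      with True have "R = 0" by simp
      then have "a j ^ Suc n \<le> 0"
        using R member_le_sum[of j J "\<lambda>j. a j ^ Suc n"] that fin assms(1) by auto
      then have "a j = 0" using assms(1)[OF that(2)] by (metis less_le zero_less_power not_less)
      then show ?thesis using that False by simp
    qed
    \<comment> \<open>For n = 0 the factor \<open>a j ^ 0\<close> is 1 even if \<open>a j\<close> is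
      0, so the summands need not vanish; the claim is then the hypothesis \<open>y\<close>
      itself.\<close>
    show ?thesis
    proof (cases "n \<noteq> 0 \<or> y = 0")
      case False
      then show ?thesis using y by simp
    next
      case True
      with zero have "(\<Sum>j\<in>J. a j ^ n * b j) = 0" by (intro sum.neutral) blast
      then show ?thesis using assms(3,4) by simp
    qed
  next
    case False
    then have pos: "0 < y" "0 < R" using assms(3,4) by auto
    have "(\<Sum>j\<in>J. real (Suc n) * ((a j / R) ^ n * (b j / y)))
        \<le> (\<Sum>j\<in>J. real n * (a j / R) ^ Suc n + (b j / y) ^ Suc n)"
      using assms(1,2) pos by (intro sum_mono weighted_power_mean) auto
    also have "\<dots> = real n * ((\<Sum>j\<in>J. a j ^ Suc n) / R ^ Suc n) + (\<Sum>j\<in>J. b j ^ Suc n) / y ^ Suc n"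
      by (simp only: sum.distrib sum_distrib_left sum_divide_distrib power_divide)
    also have "\<dots> \<le> real n * 1 + 1"
      unfolding R using y pos by (intro add_mono mult_left_mono) auto
    also have "real n * 1 + 1 = real (Suc n) * 1" by simp
    finally have "real (Suc n) * (\<Sum>j\<in>J. (a j / R) ^ n * (b j / y)) \<le> real (Suc n) * 1"
      by (simp only: sum_distrib_left)
    then have "(\<Sum>j\<in>J. (a j / R) ^ n * (b j / y)) \<le> 1"
      by (rule mult_left_le_imp_le) (rule of_nat_0_less_iff[THEN iffD2, OF zero_less_Suc])
    also have "(\<Sum>j\<in>J. (a j / R) ^ n * (b j / y)) = (\<Sum>j\<in>J. a j ^ n * b j) / (R ^ n * y)"
      by (simp add: sum_divide_distrib power_divide)
    finally show ?thesis using pos by (simp add: divide_simps)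
  qed
qed (use assms in simp)

text \<open>Minkowski's integral inequality in l^d: with v_j(t) = level_j(t)^(1/d), the l^d norm of
  v(t) is the d-th root of the level of the union, as levels of disjoint sets add. It is proved by
  duality: one factor of a_j^d is opened as an integral, \<open>discrete_Hoelder\<close> is applied
  at each height, and R^(d-1) is cancelled.\<close>

lemma lnorm_superadditive:
  fixes g :: "real^'n::finite \<Rightarrow> real"
  assumes g: "g \<in> borel_measurable lebesgue" and J: "finite J"
    and S: "\<And>j. j \<in> J \<Longrightarrow> S j \<in> lmeasurable" "disjoint_family_on S J"
    and fin: "lnorm g (\<Union>j\<in>J. S j) < \<infinity>"
  shows "(\<Sum>j\<in>J. enn2real (lnorm g (S j)) ^ CARD('n)) \<le> enn2real (lnorm g (\<Union>j\<in>J. S j)) ^ CARD('n)"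
proof -
  let ?d = "CARD('n)"
  obtain n where n: "?d = Suc n" using not0_implies_Suc[of ?d] by auto
  let ?T = "\<Union>j\<in>J. S j"
  define a where "a j = enn2real (lnorm g (S j))" for j
  define R where "R = root ?d (\<Sum>j\<in>J. a j ^ ?d)"
  have a0: "0 \<le> a j" for j by (simp add: a_def)
  have "0 \<le> (\<Sum>j\<in>J. a j ^ ?d)" by (intro sum_nonneg zero_le_power a0)
  then have R: "0 \<le> R" "R ^ ?d = (\<Sum>j\<in>J. a j ^ ?d)"
    unfolding R_def by (auto intro: real_root_pow_pos2)
  have T: "?T \<in> lmeasurable" using J S(1) by (intro fmeasurable.finite_UN) auto
  have lnorm_eq: "lnorm g (S j) = ennreal (a j)" if "j \<in> J" for j
  proof -
    have "lnorm g (S j) \<le> lnorm g ?T" using that by (intro lnorm_mono g S(1) T) auto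
    then have "lnorm g (S j) < top" using fin by (simp add: le_less_trans)
    then show ?thesis by (simp add: a_def)
  qed
  let ?r = "\<lambda>m. m powr (1 / ?d)"
  have root_pow: "?r m ^ ?d = m" if "0 \<le> m" for m :: real
    using that by (cases "m = 0") (auto simp: powr_realpow[symmetric] powr_powr power_0_left)
  have [measurable]: "level g (S j) \<in> borel_measurable borel" if "j \<in> J" for j
    using S(1)[OF that] by (rule borel_measurable_level[OF g])
  have [measurable]: "level g ?T \<in> borel_measurable borel"
    using T by (rule borel_measurable_level[OF g])
  have level_sum: "(\<Sum>j\<in>J. level g (S j) t) = level g ?T t" for t
  proof -
    have "measure lebesgue (\<Union>j\<in>J. {x \<in> S j. t < g x}) = (\<Sum>j\<in>J. measure lebesgue {x \<in> S j. t < g x})"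
    proof (rule measure_finite_Union[OF J])
      show "(\<lambda>j. {x \<in> S j. t < g x}) ` J \<subseteq> sets lebesgue"
        using lmeasurable_level[OF g S(1)] by blast
      show "disjoint_family_on (\<lambda>j. {x \<in> S j. t < g x}) J"
        using S(2) by (auto simp: disjoint_family_on_def)
      show "emeasure lebesgue {x \<in> S j. t < g x} \<noteq> \<infinity>" if "j \<in> J" for j
        using fmeasurableD2[OF lmeasurable_level[OF g S(1)[OF that]]] by simp
    qed
    moreover have "(\<Union>j\<in>J. {x \<in> S j. t < g x}) = {x \<in> ?T. t < g x}" by blast
    ultimately show ?thesis by (simp add: level_def)
  qed
  have pt: "(\<Sum>j\<in>J. a j ^ n * ?r (level g (S j) t)) \<le> R ^ n * ?r (level g ?T t)" for t
  proof (rule discrete_Hoelder)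
    show "(\<Sum>j\<in>J. ?r (level g (S j) t) ^ Suc n) \<le> ?r (level g ?T t) ^ Suc n"
      unfolding n[symmetric] by (simp add: root_pow level_sum)
  qed (use R a0 n in auto)
  have "R ^ Suc n = (\<Sum>j\<in>J. a j ^ n * a j)"
    using R(2) unfolding n power_Suc2 .
  then have "ennreal (R ^ Suc n) = (\<Sum>j\<in>J. ennreal (a j ^ n * a j))"
    using a0 by (simp only: sum_ennreal zero_le_power mult_nonneg_nonneg)
  also have "\<dots> = (\<Sum>j\<in>J. ennreal (a j ^ n) * lnorm g (S j))"
    using a0 by (intro sum.cong refl) (simp only: lnorm_eq ennreal_mult zero_le_power)
  also have "\<dots> = (\<Sum>j\<in>J. \<integral>\<^sup>+ t. ennreal (a j ^ n) * (ennreal (?r (level g (S j) t)) * indicator {0<..} t) \<partial>lborel)"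
    unfolding lnorm_def by (intro sum.cong refl nn_integral_cmult[symmetric]) measurable
  also have "\<dots> = (\<integral>\<^sup>+ t. (\<Sum>j\<in>J. ennreal (a j ^ n) * (ennreal (?r (level g (S j) t)) * indicator {0<..} t)) \<partial>lborel)"
    by (intro nn_integral_sum[symmetric]) measurable
  also have "\<dots> \<le> (\<integral>\<^sup>+ t. ennreal (R ^ n) * (ennreal (?r (level g ?T t)) * indicator {0<..} t) \<partial>lborel)"
  proof (rule nn_integral_mono)
    fix t
    have "(\<Sum>j\<in>J. ennreal (a j ^ n) * (ennreal (?r (level g (S j) t)) * indicator {0<..} t))
        = ennreal (\<Sum>j\<in>J. a j ^ n * ?r (level g (S j) t)) * indicator {0<..} t"
      using a0 by (simp add: sum_ennreal[symmetric] ennreal_mult sum_distrib_right mult.assoc)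
    also have "\<dots> \<le> ennreal (R ^ n * ?r (level g ?T t)) * indicator {0<..} t"
      by (intro mult_right_mono ennreal_leI pt) simp
    finally show "(\<Sum>j\<in>J. ennreal (a j ^ n) * (ennreal (?r (level g (S j) t)) * indicator {0<..} t))
        \<le> ennreal (R ^ n) * (ennreal (?r (level g ?T t)) * indicator {0<..} t)"
      using R(1) by (simp add: ennreal_mult mult.assoc)
  qed
  also have "\<dots> = ennreal (R ^ n) * lnorm g ?T"
    unfolding lnorm_def by (rule nn_integral_cmult) measurable
  also have "\<dots> = ennreal (R ^ n * enn2real (lnorm g ?T))"
    using fin R(1) by (simp add: ennreal_mult)
  finally have le: "R ^ n * R \<le> R ^ n * enn2real (lnorm g ?T)"
    using R(1) by (simp add: mult.commute)
  have "R \<le> enn2real (lnorm g ?T)"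
  proof (cases "R = 0")
    case False
    with R(1) le show ?thesis by simp
  qed simp
  then have "R ^ ?d \<le> enn2real (lnorm g ?T) ^ ?d" using R(1) by (rule power_mono)
  then show ?thesis unfolding R(2) a_def .
qed

section \<open>The weak type inequality\<close>

text \<open>Local estimates come on cubes, the Vitali covering lemma on balls. The factor d is from
  the bound of the Euclidean norm by the l^1 norm.\<close>

lemma cube_subset_cball:
  fixes x :: "real^'n::finite" and r :: real
  shows "cube x r \<subseteq> cball x (real CARD('n) * r)"
proof
  fix z assume "z \<in> cube x r"
  then have "(\<Sum>i\<in>UNIV. \<bar>(z - x) $ i\<bar>) \<le> real CARD('n) * r"
    by (intro sum_bounded_above) (simp add: mem_cube)
  with norm_le_l1_cart[of "z - x"] show "z \<in> cball x (real CARD('n) * r)"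
    by (simp add: dist_norm norm_minus_commute)
qed

lemma measure_cball_le:
  fixes x :: "real^'n::finite"
  assumes "0 \<le> s"
  shows "measure lebesgue (cball x s) \<le> (2 * s) ^ CARD('n)"
proof -
  have "cball x s \<subseteq> cube x s"
  proof
    fix z assume "z \<in> cball x s"
    then have "norm (z - x) \<le> s" by (simp add: dist_norm norm_minus_commute)
    then have "\<bar>(z - x) $ i\<bar> \<le> s" for i by (rule order_trans[OF component_le_norm_cart])
    then show "z \<in> cube x s" by (simp add: mem_cube)
  qed
  then have "measure lebesgue (cball x s) \<le> measure lebesgue (cube x s)"
    by (intro measure_mono_fmeasurable) auto
  then show ?thesis using measure_cube[OF assms, of x] by simp
qed

text \<open>The Vitali family is countable but superadditivity is for finite families; continuity
  from below along an enumeration bridges the two.\<close>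

lemma emeasure_Union_le_of_finite:
  assumes "countable C" "\<And>i. i \<in> C \<Longrightarrow> S i \<in> sets M"
    and bound: "\<And>F. finite F \<Longrightarrow> F \<subseteq> C \<Longrightarrow> emeasure M (\<Union>i\<in>F. S i) \<le> b"
  shows "emeasure M (\<Union>i\<in>C. S i) \<le> b"
proof (cases "C = {}")
  case True
  then show ?thesis by simp
next
  case False
  let ?U = "\<lambda>n. \<Union>i\<in>from_nat_into C ` {..<n}. S i"
  have sub: "from_nat_into C ` {..<n} \<subseteq> C" for n
    using from_nat_into[OF False] by auto
  have "(\<Union>i\<in>C. S i) = (\<Union>n. ?U n)"
  proof
    show "(\<Union>i\<in>C. S i) \<subseteq> (\<Union>n. ?U n)"
    proof
      fix x assume "x \<in> (\<Union>i\<in>C. S i)"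
      then obtain k where "x \<in> S (from_nat_into C k)"
        using from_nat_into_surj[OF assms(1)] by blast
      then have "x \<in> ?U (Suc k)" by auto
      then show "x \<in> (\<Union>n. ?U n)" by blast
    qed
    show "(\<Union>n. ?U n) \<subseteq> (\<Union>i\<in>C. S i)" using sub by blast
  qed
  also have "emeasure M (\<Union>n. ?U n) = (SUP n. emeasure M (?U n))"
  proof (rule SUP_emeasure_incseq[symmetric])
    show "range ?U \<subseteq> sets M" using sub assms(2) by (auto intro!: sets.finite_UN)
    show "incseq ?U" by (intro monoI UN_mono image_mono) auto
  qed
  also have "\<dots> \<le> b" using sub by (intro SUP_least bound) auto
  finally show ?thesis .
qed

context weak_gradient
begin

lemma mary_weiss_level_ball:
  assumes "ennreal l < mary_weiss A x" "0 < l"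
  obtains \<rho> where "0 < \<rho>"
    "ennreal (l * \<rho>) \<le> ennreal (6 * real CARD('n) * mol_const CARD('n) / mass TYPE('n)) * N (cball x \<rho>)"
proof -
  let ?K = "3 * mol_const CARD('n) / mass TYPE('n)"
  obtain h where h: "h \<noteq> 0"
    "ennreal l < ennreal (norm (continuous_rep A (x + h) - continuous_rep A x) / norm h)"
    using assms(1) unfolding mary_weiss_def less_SUP_iff by auto
  \<comment> \<open>The radius of a ball around the cube of half-side 2|h|. Multiplying the estimate
    by 2d turns |h| into this radius and 3 into 6d.\<close>
  let ?\<rho> = "2 * real CARD('n) * norm h"
  have "l * norm h \<le> norm (continuous_rep A (x + h) - continuous_rep A x)"
    using h assms(2) by (simp add: ennreal_less_iff divide_simps split: if_splits)
  then have "ennreal (l * norm h) \<le> ennreal ?K * N (cube x (2 * norm h))"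
    using continuous_rep_diff_le[OF h(1), of x] by (meson ennreal_leI order_trans)
  also have "\<dots> \<le> ennreal ?K * N (cball x ?\<rho>)"
    using cube_subset_cball[of x "2 * norm h"]
    by (intro mult_left_mono lnorm_mono measurable_norm) (auto simp: mult.assoc mult.left_commute)
  finally have "ennreal (2 * real CARD('n)) * ennreal (l * norm h)
      \<le> ennreal (2 * real CARD('n)) * (ennreal ?K * N (cball x ?\<rho>))"
    by (rule mult_left_mono) simp
  also have "ennreal (2 * real CARD('n)) * ennreal (l * norm h) = ennreal (l * ?\<rho>)"
    using assms(2) by (subst ennreal_mult[symmetric]) (auto simp: mult_ac)
  also have "ennreal (2 * real CARD('n)) * (ennreal ?K * N (cball x ?\<rho>))
      = ennreal (2 * real CARD('n) * ?K) * N (cball x ?\<rho>)"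
    using mol_const_nonneg[of "CARD('n)"] mass_pos[where 'n = 'n] by (intro ennreal_mult_assoc) auto
  also have "2 * real CARD('n) * ?K = 6 * real CARD('n) * mol_const CARD('n) / mass TYPE('n)" by simp
  finally show thesis using h(1) by (intro that[of ?\<rho>]) auto
qed

text \<open>Only a common bound \<open>L\<close> for the norms over sets of finite measure enters.
  It bounds the radii and the norm over the union of finitely many disjoint balls.\<close>

lemma mary_weiss_weak_type:
  assumes l: "0 < l" and L: "\<And>S. S \<in> lmeasurable \<Longrightarrow> N S \<le> ennreal L" "0 \<le> L"
  shows "ennreal (l ^ CARD('n)) * emeasure lebesgue {x. mary_weiss A x > ennreal l}
    \<le> ennreal ((60 * real CARD('n) * mol_const CARD('n) / mass TYPE('n)) ^ CARD('n) * L ^ CARD('n))"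
proof -
  let ?d = "CARD('n)"
  let ?E = "{x. mary_weiss A x > ennreal l}"
  define K where "K = 6 * real ?d * mol_const ?d / mass TYPE('n)"
  have K: "0 \<le> K" using mol_const_nonneg[of ?d] mass_pos[where 'n = 'n] by (simp add: K_def)
  let ?N = "\<lambda>S. enn2real (N S)"
  have N_eq: "N S = ennreal (?N S)" if "S \<in> lmeasurable" for S
    using lnorm_finite[OF that] by simp
  have "\<exists>\<rho>. 0 < \<rho> \<and> l * \<rho> \<le> K * ?N (cball x \<rho>)" if x: "x \<in> ?E" for x
  proof -
    obtain \<rho> where \<rho>: "0 < \<rho>" "ennreal (l * \<rho>) \<le> ennreal K * N (cball x \<rho>)"
    proof (rule mary_weiss_level_ball)
      show "ennreal l < mary_weiss A x" using x by simp
    qed (use l in \<open>auto simp: K_def\<close>)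
    then have "ennreal (l * \<rho>) \<le> ennreal (K * ?N (cball x \<rho>))"
      unfolding ennreal_mult[OF K enn2real_nonneg] N_eq[OF lmeasurable_cball, symmetric] by blast
    then have "l * \<rho> \<le> K * ?N (cball x \<rho>)"
      using K by (simp only: ennreal_le_iff mult_nonneg_nonneg enn2real_nonneg)
    with \<rho>(1) show ?thesis by blast
  qed
  then obtain \<rho> where \<rho>: "\<And>x. x \<in> ?E \<Longrightarrow> 0 < \<rho> x" "\<And>x. x \<in> ?E \<Longrightarrow> l * \<rho> x \<le> K * ?N (cball x (\<rho> x))"
    by metis
  have N_le: "?N S \<le> L" if "S \<in> lmeasurable" for S
    using L(1)[OF that] L(2) by (simp add: enn2real_leI)
  \<comment> \<open>The Vitali covering lemma requires bounded radii.\<close>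
  have \<rho>_bound: "\<rho> x \<le> K * L / l" if "x \<in> ?E" for x
  proof -
    have "K * ?N (cball x (\<rho> x)) \<le> K * L" by (intro mult_left_mono N_le K) simp
    with \<rho>(2)[OF that] l show ?thesis by (simp add: divide_simps mult.commute)
  qed
  have cover: "?E \<subseteq> (\<Union>x\<in>?E. cball x (\<rho> x))" using \<rho>(1) by (force intro: less_imp_le)
  have radii: "0 < \<rho> x \<and> \<rho> x \<le> K * L / l" if "x \<in> ?E" for x
    using \<rho>(1)[OF that] \<rho>_bound[OF that] ..
  obtain C where C: "countable C" "C \<subseteq> ?E"
    "pairwise (\<lambda>i j. disjnt (cball i (\<rho> i)) (cball j (\<rho> j))) C"
    "?E \<subseteq> (\<Union>i\<in>C. cball i (5 * \<rho> i))"
    using cover radii by (rule Vitali_covering_lemma_cballs[where a = "\<lambda>x. x"])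
  have "emeasure lebesgue (\<Union>i\<in>C. cball i (5 * \<rho> i)) \<le> ennreal ((10 * (K / l)) ^ ?d * L ^ ?d)"
  proof (rule emeasure_Union_le_of_finite[OF C(1)])
    fix F assume F: "finite F" "F \<subseteq> C"
    have FE: "i \<in> ?E" if "i \<in> F" for i using that F C(2) by blast
    let ?T = "\<Union>i\<in>F. cball i (\<rho> i)"
    have T: "?T \<in> lmeasurable" using F(1) by (intro fmeasurable.finite_UN) auto
    have "emeasure lebesgue (\<Union>i\<in>F. cball i (5 * \<rho> i)) \<le> (\<Sum>i\<in>F. emeasure lebesgue (cball i (5 * \<rho> i)))"
      by (intro emeasure_subadditive_finite F) auto
    also have "\<dots> = ennreal (\<Sum>i\<in>F. measure lebesgue (cball i (5 * \<rho> i)))"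
      using lmeasurable_cball by (subst sum_ennreal[symmetric]) (auto simp: emeasure_eq_measure2)
    also have "(\<Sum>i\<in>F. measure lebesgue (cball i (5 * \<rho> i))) \<le> (\<Sum>i\<in>F. (10 * (K / l)) ^ ?d * ?N (cball i (\<rho> i)) ^ ?d)"
    proof (rule sum_mono)
      fix i assume i: "i \<in> F"
      \<comment> \<open>The enlarged ball lies in a cube of side 10 rho; the choice of rho then
        trades the radius for K/l times the norm over the original ball.\<close>
      have "measure lebesgue (cball i (5 * \<rho> i)) \<le> (10 * \<rho> i) ^ ?d"
        using measure_cball_le[of "5 * \<rho> i" i] \<rho>(1)[OF FE[OF i]] by simp
      also have "\<dots> \<le> (10 * (K / l * ?N (cball i (\<rho> i)))) ^ ?d"
        using \<rho>[OF FE[OF i]] l by (intro power_mono mult_left_mono) (auto simp: divide_simps mult.commute)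
      finally show "measure lebesgue (cball i (5 * \<rho> i)) \<le> (10 * (K / l)) ^ ?d * ?N (cball i (\<rho> i)) ^ ?d"
        by (simp add: power_mult_distrib power_divide)
    qed
    also have "(\<Sum>i\<in>F. (10 * (K / l)) ^ ?d * ?N (cball i (\<rho> i)) ^ ?d)
        = (10 * (K / l)) ^ ?d * (\<Sum>i\<in>F. ?N (cball i (\<rho> i)) ^ ?d)"
      by (simp add: sum_distrib_left)
    also have "\<dots> \<le> (10 * (K / l)) ^ ?d * L ^ ?d"
    proof (rule mult_left_mono)
      have "disjoint_family_on (\<lambda>i. cball i (\<rho> i)) F"
        using C(3) F(2) unfolding disjoint_family_on_def pairwise_def disjnt_def by blast
      then have "(\<Sum>i\<in>F. ?N (cball i (\<rho> i)) ^ ?d) \<le> ?N ?T ^ ?d"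
        by (intro lnorm_superadditive measurable_norm F(1) lnorm_finite T) auto
      also have "\<dots> \<le> L ^ ?d" by (intro power_mono N_le T) simp
      finally show "(\<Sum>i\<in>F. ?N (cball i (\<rho> i)) ^ ?d) \<le> L ^ ?d" .
    qed (use K l in simp)
    finally show "emeasure lebesgue (\<Union>i\<in>F. cball i (5 * \<rho> i)) \<le> ennreal ((10 * (K / l)) ^ ?d * L ^ ?d)"
      by (simp add: ennreal_leI)
  qed auto
  moreover have "emeasure lebesgue ?E \<le> emeasure lebesgue (\<Union>i\<in>C. cball i (5 * \<rho> i))"
    using C(1,4) by (intro emeasure_mono sets.countable_UN') auto
  ultimately have "emeasure lebesgue ?E \<le> ennreal ((10 * (K / l)) ^ ?d * L ^ ?d)" by (rule order_trans[rotated])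
  then have "ennreal (l ^ ?d) * emeasure lebesgue ?E \<le> ennreal (l ^ ?d) * ennreal ((10 * (K / l)) ^ ?d * L ^ ?d)"
    by (rule mult_left_mono) simp
  also have "\<dots> = ennreal (l ^ ?d * ((10 * (K / l)) ^ ?d * L ^ ?d))"
    using l K L(2) by (intro ennreal_mult[symmetric]) auto
  also have "l ^ ?d * ((10 * (K / l)) ^ ?d * L ^ ?d) = (10 * K) ^ ?d * L ^ ?d"
    using l by (simp add: power_mult_distrib power_divide)
  also have "10 * K = 60 * real ?d * mol_const ?d / mass TYPE('n)" by (simp add: K_def)
  finally show ?thesis .
qed

end

theorem lemma2p2:
  assumes "CARD('n::finite) \<ge> 2"
  shows "\<exists>C::real. C \<ge> 0 \<and>
    (\<forall>(A :: real^'n \<Rightarrow> complex) G.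
       A has_weak_gradient G \<longrightarrow>
       (\<lambda>x. norm (G x)) \<in> lorentz_space (real CARD('n)) \<longrightarrow>
       (\<forall>l::real. l > 0 \<longrightarrow>
          ennreal (l ^ CARD('n)) * emeasure lebesgue {x. mary_weiss A x > ennreal l}
            \<le> ennreal C * lorentz_norm (real CARD('n)) (\<lambda>x. norm (G x)) ^ CARD('n)))"
proof (intro exI conjI allI impI)
  \<comment> \<open>60 is 10, the side of the cube around a fivefold ball per unit of radius, times
    6 from \<open>mary_weiss_level_ball\<close>.\<close>
  let ?C = "(60 * real CARD('n) * mol_const CARD('n) / mass TYPE('n)) ^ CARD('n)"
  show C: "0 \<le> ?C"
    using mol_const_nonneg[of "CARD('n)"] mass_pos[where 'n = 'n] by simp
  fix A :: "real^'n \<Rightarrow> complex" and G and l :: real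
  assume A: "A has_weak_gradient G" and l: "0 < l"
    and G: "(\<lambda>x. norm (G x)) \<in> lorentz_space (real CARD('n))"
  let ?L = "lorentz_norm (real CARD('n)) (\<lambda>x. norm (G x))"
  have meas: "(\<lambda>x. norm (G x)) \<in> borel_measurable lebesgue" and fin: "?L < \<infinity>"
    using G by (auto simp: lorentz_space_def)
  have le: "lnorm (\<lambda>x. norm (G x)) S \<le> ?L" if "S \<in> lmeasurable" for S
    by (rule lnorm_le_lorentz_norm[OF meas that]) simp
  interpret weak_gradient A G
    by standard (use A meas assms le fin in \<open>auto intro: le_less_trans\<close>)
  have L: "?L = ennreal (enn2real ?L)" using fin by simp
  have "ennreal (l ^ CARD('n)) * emeasure lebesgue {x. mary_weiss A x > ennreal l}
      \<le> ennreal (?C * enn2real ?L ^ CARD('n))"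
    using le L by (intro mary_weiss_weak_type[OF l]) auto
  also have "\<dots> = ennreal ?C * ennreal (enn2real ?L) ^ CARD('n)"
    using C by (simp add: ennreal_mult ennreal_power del: ennreal_enn2real)
  finally show "ennreal (l ^ CARD('n)) * emeasure lebesgue {x. mary_weiss A x > ennreal l}
      \<le> ennreal ?C * ?L ^ CARD('n)"
    using L by simp
qed

end
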